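(* Consider the two-person zero-sum risk-sensitive average stochastic game with finite state and action spaces described in the context, and assume the irreducibility condition: for every pair of deterministic stationary policies $(f,g)\in\Pi_1^{sd}\times\Pi_2^{sd}$, the Markov chain $\{X_n,n\in\mathbb{N}\}$ is irreducible under $(f,g)$. Fix a state $i_*\in E$, let $M_c:=\max_{(i,a,b)\in\mathbb{K}}c(i,a,b)-\min_{(i,a,b)\in\mathbb{K}}c(i,a,b)$ and assume $M_c>0$. Let $\gamma$ be the irreducibility coefficient (defined in the context), let $\varepsilon>0$, and suppose $\theta\in\big(0,\frac{-\ln(1-\gamma)}{|E|M_c}\big)$ (with $-\ln 0:=\infty$). Let $\lambda_*=\lim_{n\to\infty}\|\mathcal{L}^n\mathbf{1}\|^{1/n}$, and let $h^*:E\to(0,\infty)$ satisfy $\lambda_*h^*=\mathcal{L}h^*$ and $h^*(i_* )=1$ (under the irreducibility condition this limit and such a function exist). Let $k_\varepsilon$, $N_\varepsilon$, $\rho_\varepsilon$ and the functions $U_n^\varepsilon$ ($n\in\mathbb{N}$) be as defined in the context. Then: (a) The function $U_{N_\varepsilon}^\varepsilon$ satisfies $U_{N_\varepsilon}^\varepsilon\le h^*\le e^{\theta\varepsilon}U_{N_\varepsilon}^\varepsilon$ pointwise on $E$. (b) For each $i\in E$, let $(w_\varepsilon(i),\varphi_\varepsilon(\cdot|i))$ and $(v_\varepsilon(i),\psi_\varepsilon(\cdot|i))$ be optimal solutions, respectively, of the linear program $$\min_{w,\mu}\ w\quad\text{s.t. } w\ge\mathcal{L}^{\mu,\delta_b}h(i)\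 \ \forall b\in B(i),\quad \sum_{a\in A(i)}\mu(a)=1,\quad \mu(a)\ge0\ \ \forall a\in A(i),$$ and of its dual program $$\max_{v,\nu}\ v\quad\text{s.t. } v\le\mathcal{L}^{\delta_a,\nu}h(i)\ \ \forall a\in A(i),\quad \sum_{b\in B(i)}\nu(b)=1,\quad \nu(b)\ge0\ \ \forall b\in B(i),$$ both with $h=U_{N_\varepsilon}^\varepsilon$. Then $(\varphi_\varepsilon,\psi_\varepsilon)$ is an $\varepsilon$-saddle point of the game.
   Context: Game data: $\theta\in(0,\infty)$ is a risk-sensitivity parameter; $E$ (states), $A$, $B$ (actions of players 1 and 2) are finite nonempty sets, $|E|$ is the cardinality of $E$; for each $i\in E$, $A(i)\subset A$ and $B(i)\subset B$ are the nonempty sets of admissible actions; $\mathbb{K}:=\{(i,a,b): i\in E,a\in A(i),b\in B(i)\}$; $P(\cdot|i,a,b)$ is a probability distribution on $E$ for each $(i,a,b)\in\mathbb{K}$; $c:\mathbb{K}\to[0,\infty)$ is the cost to player 1 and reward to player 2 (assumed nonnegative). $\mathbb{N}=\{0,1,2,\ldots\}$. Policies: Let $H_0=E$, $H_n=\mathbb{K}^n\times E$ for $n\ge1$. A (randomized history-dependent) policy of player 1 is a sequence $\pi=\{\pi_n,n\in\mathbb{N}\}$ of stochastic kernels $\pi_n$ on $A$ given $H_n$ with $\pi_n(A(i_n)|h_n)=1$ for all $h_n=(i_0,a_0,b_0,\ldots,i_{n-1},a_{n-1},b_{n-1},i_n)\in H_n$. It is stationary if there is a stochastic kernel $\varphi$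 on $A$ given $E$ with $\pi_n(\cdot|h_n)=\varphi(\cdot|i_n)$ for all $n,h_n$ (then $\pi$ is written $\varphi$), and deterministic stationary if moreover $\varphi(\cdot|i)=\delta_{f(i)}$ for a map $f:E\to A$ (then written $f$). $\Pi_1$ and $\Pi_1^{sd}$ are the sets of all policies and of all deterministic stationary policies of player 1; $\Pi_2,\Pi_2^{sd}$ are defined analogously for player 2 with $B,B(i)$. For $i\in E$, $(\pi,\sigma)\in\Pi_1\times\Pi_2$, $\mathbb{P}_i^{\pi,\sigma}$ is the unique probability measure on $(E\times A\times B)^\infty$ with coordinate processes $X_n,A_n,B_n$ such that $X_0=i$ a.s.; given the history $h_n$ up to time $n$, $A_n$ and $B_n$ are independent with laws $\pi_n(\cdot|h_n)$, $\sigma_n(\cdot|h_n)$; and given $h_n,a_n,b_n$, $X_{n+1}$ has law $P(\cdot|i_n,a_n,b_n)$. $\mathbb{E}_i^{\pi,\sigma}$ is its expectation. Irreducible means: for all $i,j\in E$ there is $n\ge1$ with $\mathbb{P}_i^{f,g}(X_n=j)>0$. Criterion: $J(i,\pi,\sigma):=\limsup_{n\to\infty}\frac{1}{\theta n}\ln\mathbb{E}_i^{\pi,\sigma}\big[e^{\theta\sum_{k=0}^{n-1}c(X_k,A_k,B_k)}\big]$. The value exists if $\inf_{\pi\in\Pi_1}\sup_{\sigma\in\Pi_2}J(i,\pi,\sigma)=\sup_{\sigma\in\Pi_2}\inf_{\pi\in\Pi_1}J(i,\pi,\sigma)$ for all $i\in E$; the common function is the value $J^*(i)$. (Under the irreducibility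 condition the value exists and equals the constant $\rho^*=\theta^{-1}\ln\lambda_*$.) A pair $(\pi^\varepsilon,\sigma^\varepsilon)\in\Pi_1\times\Pi_2$ is an $\varepsilon$-saddle point if $J(i,\pi^\varepsilon,\sigma)\le J^*(i)+\varepsilon$ for all $i\in E,\sigma\in\Pi_2$, and $J(i,\pi,\sigma^\varepsilon)\ge J^*(i)-\varepsilon$ for all $i\in E,\pi\in\Pi_1$. Operator: $\mathcal{P}(A(i)),\mathcal{P}(B(i))$ are the sets of probability measures on $A(i),B(i)$; $\delta_x$ is the Dirac measure at $x$, and $\delta_{i_*}(i)=1$ if $i=i_*$, $0$ otherwise. For $h:E\to[0,\infty)$, $$\mathcal{L}^{\mu,\nu}h(i):=\sum_{a\in A(i)}\sum_{b\in B(i)}\sum_{j\in E}e^{\theta c(i,a,b)}h(j)P(j|i,a,b)\mu(a)\nu(b),\qquad \mathcal{L}h(i):=\inf_{\mu\in\mathcal{P}(A(i))}\sup_{\nu\in\mathcal{P}(B(i))}\mathcal{L}^{\mu,\nu}h(i),$$ $\mathcal{L}^0h=h$, $\mathcal{L}^nh=\mathcal{L}(\mathcal{L}^{n-1}h)$; $\|h\|:=\max_{i\in E}|h(i)|$; $\mathbf{1}$ is the constant function one on $E$. Irreducibility coefficient: $\gamma:=\min_{(i,j)\in E^2}\inf_{\pi\in\Pi_1}\inf_{\sigma\in\Pi_2}\mathbb{P}_i^{\pi,\sigma}(\tau_j\le|E|)$ with $\tau_j:=\inf\{n>0\mid X_n=j\}$, $\inf\emptyset:=+\infty$. (Under the irreducibility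 condition, $\gamma>0$.) Constants: if $\gamma<1$, $$k_\varepsilon:=\min\Big\{k\ge1\ \Big|\ k>\frac{\ln\gamma+\ln\big(1-(1-\gamma)e^{\theta|E|M_c}\big)+\ln\big(e^{\theta\varepsilon/2}-1\big)-2\theta|E|M_c}{\theta|E|M_c+\ln(1-\gamma)}\Big\}$$ ($k$ integer), and $k_\varepsilon:=1$ if $\gamma=1$. $N_\varepsilon:=k_\varepsilon|E|$. Approximation $\rho_\varepsilon$ of the value: for $n\in\mathbb{N}$ let $\lambda_n:=(\max_{i\in E}\mathcal{L}^{2^n}\mathbf{1}(i))^{1/2^n}$ and $\zeta_n:=(\min_{i\in E}\mathcal{L}^{2^n}\mathbf{1}(i))^{1/2^n}$; then $\rho_\varepsilon:=\theta^{-1}\ln\lambda_n$ for the first $n\ge1$ with $\lambda_n/\zeta_n\le e^{\theta\varepsilon/(2N_\varepsilon)}$. It satisfies $0\le\rho_\varepsilon-\rho^*\le\varepsilon/(2N_\varepsilon)$. Functions: $U_0^\varepsilon(i):=\delta_{i_*}(i)$ and $U_{n+1}^\varepsilon(i):=\delta_{i_*}(i)+e^{-\theta\rho_\varepsilon}(1-\delta_{i_*}(i))\mathcal{L}U_n^\varepsilon(i)$, $i\in E$, $n\in\mathbb{N}$. *)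

theory Defs
  imports "HOL-Probability.Probability"
begin

text \<open>
  The finite state space \<open>E\<close> and action spaces \<open>A\<close>, \<open>B\<close> are (nonempty, by HOL) finite types.
  Transition laws and costs outside the set of admissible triples are irrelevant junk.
\<close>

record ('e, 'a, 'b) game =
  theta :: real
  actA :: "'e \<Rightarrow> 'a set"
  actB :: "'e \<Rightarrow> 'b set"
  trans_law :: "'e \<Rightarrow> 'a \<Rightarrow> 'b \<Rightarrow> 'e pmf"
  cost :: "'e \<Rightarrow> 'a \<Rightarrow> 'b \<Rightarrow> real"

definition admissible :: "('e::finite, 'a::finite, 'b::finite) game \<Rightarrow> ('e \<times> 'a \<times> 'b) set" where
  "admissible G = {(i, a, b). a \<in> actA G i \<and> b \<in> actB G i}"

definition is_game :: "('e::finite, 'a::finite, 'b::finite) game \<Rightarrow> bool" where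
  "is_game G \<longleftrightarrow> theta G > 0 \<and> (\<forall>i. actA G i \<noteq> {}) \<and> (\<forall>i. actB G i \<noteq> {}) \<and>
     (\<forall>(i, a, b) \<in> admissible G. cost G i a b \<ge> 0)"

section \<open>Policies\<close>

text \<open>
  A history \<open>(i\<^sub>0,a\<^sub>0,b\<^sub>0,\<dots>,i\<^sub>n\<^sub>-\<^sub>1,a\<^sub>n\<^sub>-\<^sub>1,b\<^sub>n\<^sub>-\<^sub>1,i\<^sub>n)\<close> is the list of the \<open>n\<close> past triples, oldest first,
  together with the current state; the time \<open>n\<close> is the length of the list, so one function
  on histories is the whole sequence of kernels.
\<close>

type_synonym ('e, 'a, 'b, 'c) policy = "('e \<times> 'a \<times> 'b) list \<Rightarrow> 'e \<Rightarrow> 'c pmf"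

definition policies1 :: "('e::finite, 'a::finite, 'b::finite) game \<Rightarrow> ('e, 'a, 'b, 'a) policy set" where
  "policies1 G = {\<pi>. \<forall>hs i. set hs \<subseteq> admissible G \<longrightarrow> set_pmf (\<pi> hs i) \<subseteq> actA G i}"

definition policies2 :: "('e::finite, 'a::finite, 'b::finite) game \<Rightarrow> ('e, 'a, 'b, 'b) policy set" where
  "policies2 G = {\<sigma>. \<forall>hs i. set hs \<subseteq> admissible G \<longrightarrow> set_pmf (\<sigma> hs i) \<subseteq> actB G i}"

definition stationary :: "('e \<Rightarrow> 'c pmf) \<Rightarrow> ('e, 'a, 'b, 'c) policy" where
  "stationary \<phi> = (\<lambda>hs i. \<phi> i)"

definition det_stationary :: "('e \<Rightarrow> 'c) \<Rightarrow> ('e, 'a, 'b, 'c) policy" where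
  "det_stationary f = stationary (\<lambda>i. return_pmf (f i))"

definition det_policies1 :: "('e::finite, 'a::finite, 'b::finite) game \<Rightarrow> ('e, 'a, 'b, 'a) policy set" where
  "det_policies1 G = policies1 G \<inter> range det_stationary"

definition det_policies2 :: "('e::finite, 'a::finite, 'b::finite) game \<Rightarrow> ('e, 'a, 'b, 'b) policy set" where
  "det_policies2 G = policies2 G \<inter> range det_stationary"

section \<open>The controlled process\<close>

text \<open>
  Conditional law of \<open>(X\<^sub>n, A\<^sub>n, B\<^sub>n)\<close> given the triples \<open>\<omega> 0, \<dots>, \<omega> (n - 1)\<close>.
\<close>

definition step_law :: "('e::finite, 'a::finite, 'b::finite) game \<Rightarrow> 'e \<Rightarrow>
    ('e, 'a, 'b, 'a) policy \<Rightarrow> ('e, 'a, 'b, 'b) policy \<Rightarrow> nat \<Rightarrow> (nat \<Rightarrow> 'e \<times> 'a \<times> 'b) \<Rightarrow>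
    ('e \<times> 'a \<times> 'b) pmf" where
  "step_law G i \<pi> \<sigma> n \<omega> =
     bind_pmf (case n of 0 \<Rightarrow> return_pmf i
                | Suc m \<Rightarrow> (case \<omega> m of (x, a, b) \<Rightarrow> trans_law G x a b))
       (\<lambda>x. map_pmf (Pair x)
          (pair_pmf (\<pi> (map \<omega> [0..<n]) x) (\<sigma> (map \<omega> [0..<n]) x)))"

text \<open>
  The measure on infinite paths generated by these kernels (Ionescu-Tulcea); it is characterized
  by its finite-dimensional distributions, computed in \<open>emeasure_path_cylinder\<close> below.
\<close>

definition path_measure :: "('e::finite, 'a::finite, 'b::finite) game \<Rightarrow> 'e \<Rightarrow>
    ('e, 'a, 'b, 'a) policy \<Rightarrow> ('e, 'a, 'b, 'b) policy \<Rightarrow> (nat \<Rightarrow> 'e \<times> 'a \<times> 'b) measure" where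
  "path_measure G i \<pi> \<sigma> =
     projective_family.lim UNIV
       (Ionescu_Tulcea.CI (\<lambda>n \<omega>. measure_pmf (step_law G i \<pi> \<sigma> n \<omega>)) (\<lambda>_. count_space UNIV))
       (\<lambda>_. count_space UNIV)"

lemma Ionescu_Tulcea_step_law:
  "Ionescu_Tulcea (\<lambda>n \<omega>. measure_pmf (step_law G i \<pi> \<sigma> n \<omega>)) (\<lambda>_. count_space UNIV)"
proof
  fix n :: nat
  have *: "PiM {0..<n} (\<lambda>_. count_space (UNIV :: ('a \<times> 'b \<times> 'c) set)) =
      count_space (PiE {0..<n} (\<lambda>_. UNIV))"
    by (intro count_space_PiM_finite) auto
  show "(\<lambda>\<omega>. measure_pmf (step_law G i \<pi> \<sigma> n \<omega>)) \<in>
      measurable (PiM {0..<n} (\<lambda>_. count_space UNIV)) (subprob_algebra (count_space UNIV))"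
    unfolding * by (auto intro!: measure_pmf_in_subprob_algebra)
qed

lemma emeasure_path_cylinder:
  "emeasure (path_measure G i \<pi> \<sigma>) {\<omega>. \<forall>k<n. \<omega> k = s k} = (\<Prod>k<n. ennreal (pmf (step_law G i \<pi> \<sigma> k s) (s k)))"
proof -
  let ?P = "\<lambda>n \<omega>. measure_pmf (step_law G i \<pi> \<sigma> n \<omega>)"
  let ?M = "\<lambda>_::nat. count_space (UNIV :: ('a \<times> 'b \<times> 'c) set)"
  interpret IT: Ionescu_Tulcea ?P ?M
    by (rule Ionescu_Tulcea_step_law)
  have PiM: "PiM {0..<m} ?M = count_space (PiE {0..<m} (\<lambda>_. UNIV))" for m
    by (intro count_space_PiM_finite) auto
  have step_cong: "step_law G i \<pi> \<sigma> m (restrict s {0..<m}) = step_law G i \<pi> \<sigma> m s" for m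
  proof -
    have "map (restrict s {0..<m}) [0..<m] = map s [0..<m]" by simp
    thus ?thesis unfolding step_law_def by (cases m) (simp_all del: upt_Suc map_eq_conv)
  qed
  have undef: "(\<lambda>_. undefined) \<in> space (PiM {0..<0} ?M)" by (simp add: space_PiM)
  have C: "emeasure (IT.C 0 m (\<lambda>_. undefined)) {restrict s {0..<m}} =
      (\<Prod>k<m. ennreal (pmf (step_law G i \<pi> \<sigma> k s) (s k)))" for m
  proof (induction m)
    case 0
    show ?case by (simp add: PiM_empty restrict_def)
  next
    case (Suc m)
    let ?C = "IT.C 0 m (\<lambda>_. undefined)" and ?r = "restrict s {0..<m}"
    have sC: "sets ?C = sets (PiM {0..<m} ?M)" using IT.sets_C[OF undef, of m] by simp
    hence spC: "space ?C = PiE {0..<m} (\<lambda>_. UNIV)"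
      using sets_eq_imp_space_eq[OF sC] by (simp add: PiM)
    have mem: "{restrict s {0..<Suc m}} \<in> sets (PiM {0..<Suc m} ?M)"
      by (simp add: PiM)
    have "emeasure (IT.C 0 (Suc m) (\<lambda>_. undefined)) {restrict s {0..<Suc m}} =
        (\<integral>\<^sup>+\<omega>. emeasure (IT.eP m \<omega>) {restrict s {0..<Suc m}} \<partial>?C)"
      unfolding IT.C.simps
    proof (subst emeasure_bind[where N = "PiM {0..<Suc m} ?M"])
      show "space ?C \<noteq> {}" by (simp add: spC PiE_eq_empty_iff)
      show "IT.eP (0 + m) \<in> measurable ?C (subprob_algebra (PiM {0..<Suc m} ?M))"
        unfolding measurable_cong_sets[OF sC refl] using IT.measurable_eP[of m] by simp
      show "{restrict s {0..<Suc m}} \<in> sets (PiM {0..<Suc m} ?M)" by (rule mem)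
    qed simp
    also have "\<dots> = (\<integral>\<^sup>+\<omega>. ennreal (pmf (step_law G i \<pi> \<sigma> m s) (s m)) * indicator {?r} \<omega> \<partial>?C)"
    proof (rule nn_integral_cong)
      fix \<omega> assume "\<omega> \<in> space ?C"
      hence w: "\<omega> \<in> PiE {0..<m} (\<lambda>_. UNIV)" by (simp add: spC)
      hence w': "\<omega> \<in> space (PiM {0..<m} ?M)" by (simp add: PiM)
      have upd: "(fun_upd \<omega> m x = restrict s {0..<Suc m}) \<longleftrightarrow> \<omega> = ?r \<and> x = s m" for x
      proof
        assume eq: "fun_upd \<omega> m x = restrict s {0..<Suc m}"
        have "\<omega> k = ?r k" for k
          using fun_cong[OF eq, of k] w
          by (cases "k < m"; cases "k = m") (auto simp: PiE_def extensional_def)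
        thus "\<omega> = ?r \<and> x = s m" using fun_cong[OF eq, of m] by auto
      qed (auto simp: restrict_def fun_eq_iff)
      have "(\<lambda>x. fun_upd \<omega> m x) -` {restrict s {0..<Suc m}} = (if \<omega> = ?r then {s m} else {})"
        by (auto simp: vimage_def upd)
      thus "emeasure (IT.eP m \<omega>) {restrict s {0..<Suc m}} =
          ennreal (pmf (step_law G i \<pi> \<sigma> m s) (s m)) * indicator {?r} \<omega>"
        using IT.emeasure_eP[OF w' mem] step_cong[of m]
        by (auto simp: emeasure_pmf_single split: split_indicator)
    qed
    also have "\<dots> = ennreal (pmf (step_law G i \<pi> \<sigma> m s) (s m)) * emeasure ?C {?r}"
      by (rule nn_integral_cmult_indicator) (simp add: sC PiM)
    finally show ?case
      unfolding Suc.IH by (simp only: prod.lessThan_Suc mult.commute)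
  qed
  have X: "{restrict s {0..<n}} \<in> sets (PiM {0..<n} ?M)" by (simp add: PiM)
  have emb: "{\<omega>. \<forall>k<n. \<omega> k = s k} = IT.PF.emb UNIV {0..<n} {restrict s {0..<n}}"
  proof -
    have "restrict \<omega> {0..<n} = restrict s {0..<n} \<longleftrightarrow> (\<forall>k<n. \<omega> k = s k)" for \<omega>
      by (metis atLeastLessThan_iff le0 restrict_apply' restrict_ext)
    thus ?thesis by (auto simp: prod_emb_def)
  qed
  have "emeasure (path_measure G i \<pi> \<sigma>) {\<omega>. \<forall>k<n. \<omega> k = s k} =
      emeasure (IT.CI {0..<n}) {restrict s {0..<n}}"
    unfolding path_measure_def emb by (rule IT.lim[OF _ X]) simp
  also have "\<dots> = emeasure (IT.C 0 n (\<lambda>_. undefined)) {restrict s {0..<n}}"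
  proof -
    have "IT.PF.emb {0..<n} {0..<n} {restrict s {0..<n}} = {restrict s {0..<n}}"
      by (rule prod_emb_id) auto
    thus ?thesis using IT.emeasure_CI[OF order.refl X] by simp
  qed
  finally show ?thesis by (simp add: C)
qed

lemma sets_path_measure:
  "sets (path_measure G i \<pi> \<sigma>) = sets (PiM UNIV (\<lambda>_. count_space UNIV))"
proof -
  interpret IT: Ionescu_Tulcea "\<lambda>n \<omega>. measure_pmf (step_law G i \<pi> \<sigma> n \<omega>)" "\<lambda>_. count_space UNIV"
    by (rule Ionescu_Tulcea_step_law)
  show ?thesis by (simp add: path_measure_def)
qed

lemma prob_space_path_measure: "prob_space (path_measure G i \<pi> \<sigma>)"
proof
  have "space (path_measure G i \<pi> \<sigma>) = UNIV"
    using sets_eq_imp_space_eq[OF sets_path_measure] by (simp add: space_PiM)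
  thus "emeasure (path_measure G i \<pi> \<sigma>) (space (path_measure G i \<pi> \<sigma>)) = 1"
    using emeasure_path_cylinder[of G i \<pi> \<sigma> 0] by simp
qed

definition state_at :: "nat \<Rightarrow> (nat \<Rightarrow> 'e \<times> 'a \<times> 'b) \<Rightarrow> 'e" where
  "state_at n \<omega> = fst (\<omega> n)"

definition hitting_time :: "'e \<Rightarrow> (nat \<Rightarrow> 'e \<times> 'a \<times> 'b) \<Rightarrow> enat" where
  "hitting_time j \<omega> = Inf {enat n | n. n > 0 \<and> state_at n \<omega> = j}"

definition irreducible_under :: "('e::finite, 'a::finite, 'b::finite) game \<Rightarrow>
    ('e, 'a, 'b, 'a) policy \<Rightarrow> ('e, 'a, 'b, 'b) policy \<Rightarrow> bool" where
  "irreducible_under G f g \<longleftrightarrow>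
     (\<forall>i j. \<exists>n\<ge>1. measure (path_measure G i f g) {\<omega>. state_at n \<omega> = j} > 0)"

definition irreducibility_condition :: "('e::finite, 'a::finite, 'b::finite) game \<Rightarrow> bool" where
  "irreducibility_condition G \<longleftrightarrow>
     (\<forall>f \<in> det_policies1 G. \<forall>g \<in> det_policies2 G. irreducible_under G f g)"

definition irreducibility_coeff :: "('e::finite, 'a::finite, 'b::finite) game \<Rightarrow> real" where
  "irreducibility_coeff G = (MIN (i, j) \<in> UNIV. INF \<pi> \<in> policies1 G. INF \<sigma> \<in> policies2 G.
     measure (path_measure G i \<pi> \<sigma>) {\<omega>. hitting_time j \<omega> \<le> enat CARD('e)})"

section \<open>Risk-sensitive average criterion, value and saddle points\<close>

definition avg_cost :: "('e::finite, 'a::finite, 'b::finite) game \<Rightarrow> 'e \<Rightarrow>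
    ('e, 'a, 'b, 'a) policy \<Rightarrow> ('e, 'a, 'b, 'b) policy \<Rightarrow> ereal" where
  "avg_cost G i \<pi> \<sigma> = limsup (\<lambda>n. ereal (1 / (theta G * real n) *
     ln (\<integral>\<omega>. exp (theta G * (\<Sum>k<n. case \<omega> k of (x, a, b) \<Rightarrow> cost G x a b))
           \<partial>path_measure G i \<pi> \<sigma>)))"

definition is_value :: "('e::finite, 'a::finite, 'b::finite) game \<Rightarrow> ('e \<Rightarrow> ereal) \<Rightarrow> bool" where
  "is_value G V \<longleftrightarrow> (\<forall>i.
     (INF \<pi> \<in> policies1 G. SUP \<sigma> \<in> policies2 G. avg_cost G i \<pi> \<sigma>) = V i \<and>
     (SUP \<sigma> \<in> policies2 G. INF \<pi> \<in> policies1 G. avg_cost G i \<pi> \<sigma>) = V i)"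

text \<open>The definition includes the existence of the value, without which it would be meaningless.\<close>

definition eps_saddle_point :: "('e::finite, 'a::finite, 'b::finite) game \<Rightarrow> real \<Rightarrow>
    ('e, 'a, 'b, 'a) policy \<Rightarrow> ('e, 'a, 'b, 'b) policy \<Rightarrow> bool" where
  "eps_saddle_point G \<epsilon> \<pi>' \<sigma>' \<longleftrightarrow> \<pi>' \<in> policies1 G \<and> \<sigma>' \<in> policies2 G \<and>
     (\<exists>V. is_value G V \<and>
        (\<forall>i. \<forall>\<sigma> \<in> policies2 G. avg_cost G i \<pi>' \<sigma> \<le> V i + ereal \<epsilon>) \<and>
        (\<forall>i. \<forall>\<pi> \<in> policies1 G. avg_cost G i \<pi> \<sigma>' \<ge> V i - ereal \<epsilon>))"

section \<open>The operator\<close>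

text \<open>\<open>opLw\<close> is $\mathcal{L}^{\mu,\nu}$ with \<open>\<mu>\<close>, \<open>\<nu>\<close> given by their weights; \<open>opL\<close> is $\mathcal{L}$.\<close>

definition opLw :: "('e::finite, 'a::finite, 'b::finite) game \<Rightarrow> ('a \<Rightarrow> real) \<Rightarrow> ('b \<Rightarrow> real) \<Rightarrow>
    ('e \<Rightarrow> real) \<Rightarrow> 'e \<Rightarrow> real" where
  "opLw G \<mu> \<nu> h i = (\<Sum>a \<in> actA G i. \<Sum>b \<in> actB G i. \<Sum>j \<in> UNIV.
     exp (theta G * cost G i a b) * h j * pmf (trans_law G i a b) j * \<mu> a * \<nu> b)"

definition opL :: "('e::finite, 'a::finite, 'b::finite) game \<Rightarrow> ('e \<Rightarrow> real) \<Rightarrow> 'e \<Rightarrow> real" where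
  "opL G h i = (INF \<mu> \<in> {\<mu>. set_pmf \<mu> \<subseteq> actA G i}. SUP \<nu> \<in> {\<nu>. set_pmf \<nu> \<subseteq> actB G i}.
     opLw G (pmf \<mu>) (pmf \<nu>) h i)"

definition dirac :: "'c \<Rightarrow> 'c \<Rightarrow> real" where
  "dirac x = pmf (return_pmf x)"

definition max_norm :: "('e::finite \<Rightarrow> real) \<Rightarrow> real" where
  "max_norm h = (MAX i \<in> UNIV. \<bar>h i\<bar>)"

definition lambda_star :: "('e::finite, 'a::finite, 'b::finite) game \<Rightarrow> real" where
  "lambda_star G = lim (\<lambda>n. root n (max_norm ((opL G ^^ n) (\<lambda>_. 1))))"

section \<open>Constants and the approximating functions\<close>

definition cost_span :: "('e::finite, 'a::finite, 'b::finite) game \<Rightarrow> real" where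
  "cost_span G = (MAX (i, a, b) \<in> admissible G. cost G i a b)
               - (MIN (i, a, b) \<in> admissible G. cost G i a b)"

definition k_eps :: "('e::finite, 'a::finite, 'b::finite) game \<Rightarrow> real \<Rightarrow> nat" where
  "k_eps G \<epsilon> = (let \<gamma> = irreducibility_coeff G; m = theta G * real CARD('e) * cost_span G in
     if \<gamma> < 1 then
       (LEAST k. k \<ge> 1 \<and>
          real k > (ln \<gamma> + ln (1 - (1 - \<gamma>) * exp m) + ln (exp (theta G * \<epsilon> / 2) - 1) - 2 * m)
                     / (m + ln (1 - \<gamma>)))
     else 1)"

definition N_eps :: "('e::finite, 'a::finite, 'b::finite) game \<Rightarrow> real \<Rightarrow> nat" where
  "N_eps G \<epsilon> = k_eps G \<epsilon> * CARD('e)"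

definition lambda_approx :: "('e::finite, 'a::finite, 'b::finite) game \<Rightarrow> nat \<Rightarrow> real" where
  "lambda_approx G n = root (2 ^ n) (MAX i \<in> UNIV. (opL G ^^ (2 ^ n)) (\<lambda>_. 1) i)"

definition zeta_approx :: "('e::finite, 'a::finite, 'b::finite) game \<Rightarrow> nat \<Rightarrow> real" where
  "zeta_approx G n = root (2 ^ n) (MIN i \<in> UNIV. (opL G ^^ (2 ^ n)) (\<lambda>_. 1) i)"

definition rho_eps :: "('e::finite, 'a::finite, 'b::finite) game \<Rightarrow> real \<Rightarrow> real" where
  "rho_eps G \<epsilon> = ln (lambda_approx G (LEAST n. n \<ge> 1 \<and>
     lambda_approx G n / zeta_approx G n \<le> exp (theta G * \<epsilon> / (2 * real (N_eps G \<epsilon>))))) / theta G"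

primrec U_eps :: "('e::finite, 'a::finite, 'b::finite) game \<Rightarrow> 'e \<Rightarrow> real \<Rightarrow> nat \<Rightarrow> 'e \<Rightarrow> real" where
  "U_eps G i\<^sub>0 \<epsilon> 0 = dirac i\<^sub>0"
| "U_eps G i\<^sub>0 \<epsilon> (Suc n) = (\<lambda>i. dirac i\<^sub>0 i
     + exp (- theta G * rho_eps G \<epsilon>) * (1 - dirac i\<^sub>0 i) * opL G (U_eps G i\<^sub>0 \<epsilon> n) i)"

section \<open>The linear programs\<close>

definition primal_feasible :: "('e::finite, 'a::finite, 'b::finite) game \<Rightarrow> ('e \<Rightarrow> real) \<Rightarrow> 'e \<Rightarrow>
    real \<Rightarrow> ('a \<Rightarrow> real) \<Rightarrow> bool" where
  "primal_feasible G h i w \<mu> \<longleftrightarrow> (\<forall>b \<in> actB G i. w \<ge> opLw G \<mu> (dirac b) h i) \<and>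
     (\<Sum>a \<in> actA G i. \<mu> a) = 1 \<and> (\<forall>a \<in> actA G i. \<mu> a \<ge> 0)"

definition primal_optimal :: "('e::finite, 'a::finite, 'b::finite) game \<Rightarrow> ('e \<Rightarrow> real) \<Rightarrow> 'e \<Rightarrow>
    real \<Rightarrow> ('a \<Rightarrow> real) \<Rightarrow> bool" where
  "primal_optimal G h i w \<mu> \<longleftrightarrow> primal_feasible G h i w \<mu> \<and>
     (\<forall>w' \<mu>'. primal_feasible G h i w' \<mu>' \<longrightarrow> w \<le> w')"

definition dual_feasible :: "('e::finite, 'a::finite, 'b::finite) game \<Rightarrow> ('e \<Rightarrow> real) \<Rightarrow> 'e \<Rightarrow>
    real \<Rightarrow> ('b \<Rightarrow> real) \<Rightarrow> bool" where
  "dual_feasible G h i v \<nu> \<longleftrightarrow> (\<forall>a \<in> actA G i. v \<le> opLw G (dirac a) \<nu> h i) \<and>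
     (\<Sum>b \<in> actB G i. \<nu> b) = 1 \<and> (\<forall>b \<in> actB G i. \<nu> b \<ge> 0)"

definition dual_optimal :: "('e::finite, 'a::finite, 'b::finite) game \<Rightarrow> ('e \<Rightarrow> real) \<Rightarrow> 'e \<Rightarrow>
    real \<Rightarrow> ('b \<Rightarrow> real) \<Rightarrow> bool" where
  "dual_optimal G h i v \<nu> \<longleftrightarrow> dual_feasible G h i v \<nu> \<and>
     (\<forall>v' \<nu>'. dual_feasible G h i v' \<nu>' \<longrightarrow> v \<ge> v')"

end

theory Submission
  imports Defs
begin

text \<open>
  Write \<open>\<rho>\<close> for the value, \<open>\<Lambda> = exp (\<theta>\<rho>)\<close>, \<open>d\<close> for the number of states, \<open>L\<close> for the one-step min-max
  operator \<^const>\<open>opL\<close> and \<open>M\<close> for the span of the cost. The source of all estimates is the equation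
  \<open>\<Lambda> h = L h\<close> with \<open>h > 0\<close>: \<open>L\<close> is monotone and positively homogeneous, so \<open>L\<^sup>n 1\<close> is squeezed between
  multiples of \<open>\<Lambda>\<^sup>n h\<close>.

  Part (a). The function \<open>h\<close> is the fixed point of \<open>u \<mapsto> \<delta> + \<Lambda>\<^sup>-\<^sup>1 (1 - \<delta>) L u\<close>, where \<open>\<delta>\<close> is the indicator of
  the normalizing state. Let \<open>V n\<close> be the iterates of this map from \<open>\<delta>\<close>; the functions \<^const>\<open>U_eps\<close>
  are the iterates with the larger eigenvalue estimate in place of \<open>\<Lambda>\<close>. Monotonicity puts all of
  them below \<open>h\<close>. For the converse, \<open>V n\<close> is the value of a game in which the exponential cost is
  collected up to the first visit to the normalizing state, provided that it happens within \<open>n\<close> steps. Therefore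
  \<open>h - V n\<close> is at most what two players cooperating to avoid that state can collect. Since
  \<open>\<Lambda>\<close> lies between the exponentials of \<open>\<theta>\<close> times the extreme costs, one step costs a factor of at most
  \<open>exp (\<theta>M)\<close>, and by the definition of the irreducibility coefficient \<open>\<gamma>\<close> the state is avoided for \<open>d\<close>
  steps with probability at most \<open>1 - \<gamma>\<close> (\<open>max_avoid_le\<close>). So every \<open>d\<close> steps shrink the gap by
  \<open>q = (1 - \<gamma>) exp (\<theta>dM) < 1\<close>. The same estimates give \<open>h \<le> exp (\<theta>dM) / (1 - q)\<close> and
  \<open>V n \<ge> \<gamma> exp (-\<theta>dM)\<close> for \<open>n \<ge> d\<close>, and the number of steps is chosen to make the gap small relative to \<open>V n\<close>
  (\<open>eigenfunction_le_taboo_iter\<close>). This spends one factor \<open>exp (\<theta>\<epsilon>/2)\<close>; the other one is spent on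
  replacing \<open>\<Lambda>\<close> by its estimate, whose relative error \<open>exp (\<theta>\<epsilon>/(2N))\<close> is raised to the power \<open>N\<close>
  (\<open>taboo_iter_discount\<close>).

  Part (b). By the minimax theorem both linear programs for \<open>U\<close> have optimal value \<open>L U\<close>
  (\<open>primal_optimal_guarantee\<close>, \<open>dual_optimal_guarantee\<close>). Hence the first stationary strategy satisfies
  \<open>L\<^bsup>\<phi>,\<nu>\<^esup> U \<le> L U \<le> L h = \<Lambda> h \<le> \<Lambda> exp (\<theta>\<epsilon>) U\<close> for every \<open>\<nu>\<close>, and the second one satisfies the mirror image.
  An inequality \<open>L\<^bsup>\<phi>,\<nu>\<^esup> g \<le> c g\<close> with \<open>g > 0\<close>, iterated along the process, bounds the growth rate of the exponential cost
  against every history-dependent opponent by \<open>c\<close> (\<open>avg_cost_upper\<close>, \<open>avg_cost_lower\<close>). With \<open>g = h\<close> this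
  argument identifies the value, with \<open>g = U\<close> it gives the saddle-point inequalities.
\<close>

section \<open>Minimax theorem for finite matrix games\<close>

lemma obtain_pmf_of_weights:
  fixes f :: "'a::finite \<Rightarrow> real"
  assumes "\<And>a. 0 \<le> f a" "sum f UNIV = 1"
  obtains p where "pmf p = f"
proof -
  have "(\<integral>\<^sup>+a. ennreal (f a) \<partial>count_space UNIV) = 1"
    using assms by (simp add: nn_integral_count_space_finite sum_ennreal)
  then have "pmf (embed_pmf f) a = f a" for a
    using assms by (intro pmf_embed_pmf) auto
  then show thesis by (intro that[of "embed_pmf f"]) auto
qed

lemma continuous_on_Max_image:
  fixes f :: "'b \<Rightarrow> 'c::topological_space \<Rightarrow> real"
  assumes "finite B" "B \<noteq> {}" "\<And>b. b \<in> B \<Longrightarrow> continuous_on S (f b)"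
  shows "continuous_on S (\<lambda>x. Max ((\<lambda>b. f b x) ` B))"
  using assms
proof (induction B rule: finite_ne_induct)
  case (insert b B)
  have "(\<lambda>x. Max ((\<lambda>b. f b x) ` insert b B)) = (\<lambda>x. max (f b x) (Max ((\<lambda>b. f b x) ` B)))"
    using insert.hyps by (auto simp: fun_eq_iff)
  then show ?case using insert by (auto intro!: continuous_intros)
qed auto

text \<open>
  These are the mixed actions with support in \<open>A\<close>; indexing by the whole type avoids a dimension
  that depends on \<open>A\<close>.
\<close>

lemma compact_simplex:
  "compact {x :: real^'a. (\<forall>a. 0 \<le> x $ a) \<and> (\<forall>a. a \<notin> A \<longrightarrow> x $ a = 0) \<and> (\<Sum>a\<in>UNIV. x $ a) = 1}"
  (is "compact ?D")
proof -
  have "bounded ?D"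
  proof (rule boundedI)
    fix x assume "x \<in> ?D"
    moreover have "norm x \<le> (\<Sum>a\<in>UNIV. \<bar>x $ a\<bar>)" by (rule norm_le_l1_cart)
    ultimately show "norm x \<le> 1" by auto
  qed
  moreover have "closed ?D"
    by (intro closed_Collect_conj closed_Collect_all closed_Collect_imp closed_Collect_le
        closed_Collect_eq open_Collect_const continuous_on_sum continuous_on_component
        continuous_on_const continuous_on_id)
  ultimately show ?thesis by (simp add: compact_eq_bounded_closed)
qed

text \<open>
  The value is the smallest guarantee \<open>v\<close> of the row player, attained by compactness. The convex set
  of payoff vectors of mixed rows then misses the open orthant of the vectors below \<open>v\<close>, and a
  separating hyperplane has a nonnegative normal vector, which after normalization is an optimal
  mixed column.
\<close>

theorem minimax_finite:
  fixes M :: "'a::finite \<Rightarrow> 'b::finite \<Rightarrow> real"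
  assumes A: "A \<noteq> {}" and B: "B \<noteq> {}"
  obtains v p q where "set_pmf p \<subseteq> A" "set_pmf q \<subseteq> B"
    "\<And>b. b \<in> B \<Longrightarrow> (\<Sum>a\<in>A. M a b * pmf p a) \<le> v"
    "\<And>a. a \<in> A \<Longrightarrow> v \<le> (\<Sum>b\<in>B. M a b * pmf q b)"
proof -
  define D where "D = {x :: real^'a. (\<forall>a. 0 \<le> x $ a) \<and> (\<forall>a. a \<notin> A \<longrightarrow> x $ a = 0) \<and> (\<Sum>a\<in>UNIV. x $ a) = 1}"
  define g where "g = (\<lambda>b (x :: real^'a). \<Sum>a\<in>UNIV. M a b * x $ a)"
  define f where "f = (\<lambda>x. Max ((\<lambda>b. g b x) ` B))"
  have vertex: "axis a 1 \<in> D" if "a \<in> A" for a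
    using that by (auto simp: D_def axis_def)
  have "D \<noteq> {}" using A vertex by blast
  moreover have "compact D" unfolding D_def by (rule compact_simplex)
  moreover have "continuous_on D f"
    unfolding f_def g_def using B by (intro continuous_on_Max_image) (auto intro!: continuous_intros)
  ultimately obtain x where x: "x \<in> D" and min: "\<And>y. y \<in> D \<Longrightarrow> f x \<le> f y"
    using continuous_attains_inf[of D f] by blast
  define v where "v = f x"
  define C where "C = (\<lambda>y. \<chi> b. g b y) ` D"
  define L where "L = {y :: real^'b. \<forall>b\<in>B. y $ b < v}"
  have L0: "(\<chi> b. v - t) \<in> L" if "t > 0" for t using that by (simp add: L_def)
  have "convex D" unfolding D_def convex_def
    by (auto simp: sum.distrib simp flip: sum_distrib_left)
  moreover have "linear (\<lambda>y. \<chi> b. g b y)"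
    by (rule linearI)
       (auto simp: g_def vec_eq_iff algebra_simps sum.distrib sum_distrib_left)
  ultimately have "convex C" unfolding C_def by (rule convex_linear_image[rotated])
  moreover have "convex L"
  proof -
    have "L = (\<Inter>b\<in>B. {y. y $ b < v})" by (auto simp: L_def)
    moreover have "convex {y :: real^'b. y $ b < v}" for b
      using convex_halfspace_lt[of "axis b (1::real)" v] by (simp add: inner_axis')
    ultimately show ?thesis by (auto intro: convex_INT)
  qed
  moreover have "C \<noteq> {}" using \<open>D \<noteq> {}\<close> by (simp add: C_def)
  moreover have "L \<noteq> {}" using L0[of 1] by (metis empty_iff zero_less_one)
  moreover have "L \<inter> C = {}"
  proof -
    have "\<not> (\<forall>b\<in>B. g b y < v)" if "y \<in> D" for y
    proof -
      have "f y \<in> (\<lambda>b. g b y) ` B" unfolding f_def using B by (intro Max_in) auto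
      then obtain b where "b \<in> B" "f y = g b y" by auto
      then show ?thesis using min[OF that] by (auto simp: v_def not_less intro!: bexI[of _ b])
    qed
    then show ?thesis by (auto simp: C_def L_def) blast
  qed
  ultimately obtain z \<beta> where z: "z \<noteq> 0" and zL: "\<And>y. y \<in> L \<Longrightarrow> z \<bullet> y \<le> \<beta>"
    and zC: "\<And>y. y \<in> C \<Longrightarrow> \<beta> \<le> z \<bullet> y"
    using separating_hyperplane_sets[of L C] by blast
  \<comment> \<open>Coordinates outside \<open>B\<close> are unconstrained in the orthant, the others may decrease without bound.\<close>
  have ray: "t * z $ b + z \<bullet> (\<chi> b. v - 1) \<le> \<beta>" if "b \<notin> B \<or> t \<le> 0" for b t
  proof -
    have "(\<chi> b. v - 1) + axis b t \<in> L" using that by (auto simp: L_def axis_def)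
    from zL[OF this] show ?thesis by (simp add: inner_add_right inner_axis mult.commute)
  qed
  define \<kappa> where "\<kappa> = z \<bullet> (\<chi> b. v - 1)"
  have nonneg: "0 \<le> z $ b" for b
  proof (rule ccontr)
    assume neg: "\<not> 0 \<le> z $ b"
    then have "(\<bar>\<beta> - \<kappa>\<bar> + 1) / z $ b \<le> 0"
      by (intro divide_nonneg_nonpos) auto
    then have "((\<bar>\<beta> - \<kappa>\<bar> + 1) / z $ b) * z $ b + \<kappa> \<le> \<beta>"
      using ray[of b "(\<bar>\<beta> - \<kappa>\<bar> + 1) / z $ b"] by (simp add: \<kappa>_def)
    then show False using neg by simp
  qed
  have outside: "z $ b = 0" if "b \<notin> B" for b
  proof (rule ccontr)
    assume nz: "z $ b \<noteq> 0"
    have "((\<beta> - \<kappa> + 1) / z $ b) * z $ b + \<kappa> \<le> \<beta>"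
      using ray[of b "(\<beta> - \<kappa> + 1) / z $ b"] that unfolding \<kappa>_def by blast
    then show False using nz by simp
  qed
  define s where "s = (\<Sum>b\<in>UNIV. z $ b)"
  have "s > 0"
  proof -
    obtain b where "z $ b \<noteq> 0" using z by (auto simp: vec_eq_iff)
    then show ?thesis unfolding s_def using nonneg
      by (intro sum_pos2[of _ b]) (auto simp: less_le)
  qed
  \<comment> \<open>The corner \<open>(v, \<dots>, v)\<close> is only in the closure of the orthant, hence the approximation by \<open>v - e / s\<close>.\<close>
  have "s * v \<le> \<beta>"
  proof (rule field_le_epsilon)
    fix e :: real assume "e > 0"
    then have "z \<bullet> (\<chi> b. v - e / s) \<le> \<beta>" using \<open>s > 0\<close> by (intro zL L0) simp
    moreover have "z \<bullet> (\<chi> b. v - e / s) = s * (v - e / s)"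
      by (simp add: inner_vec_def s_def sum_distrib_right)
    ultimately show "s * v \<le> \<beta> + e" using \<open>s > 0\<close> by (simp add: algebra_simps)
  qed
  obtain p where p: "pmf p = (\<lambda>a. x $ a)"
    by (rule obtain_pmf_of_weights[of "\<lambda>a. x $ a"]) (use x in \<open>auto simp: D_def\<close>)
  obtain q where q: "pmf q = (\<lambda>b. z $ b / s)"
  proof (rule obtain_pmf_of_weights[of "\<lambda>b. z $ b / s"])
    show "(\<Sum>b\<in>UNIV. z $ b / s) = 1"
      using \<open>s > 0\<close> by (simp add: s_def flip: sum_divide_distrib)
  qed (use nonneg \<open>s > 0\<close> in auto)
  show thesis
  proof (rule that[of p q v])
    show "set_pmf p \<subseteq> A" using x by (auto simp: set_pmf_iff p D_def)
    show "set_pmf q \<subseteq> B" using outside by (auto simp: set_pmf_iff q) metis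
    show "(\<Sum>a\<in>A. M a b * pmf p a) \<le> v" if "b \<in> B" for b
    proof -
      have "(\<Sum>a\<in>A. M a b * pmf p a) = g b x"
        unfolding g_def p using x by (intro sum.mono_neutral_left) (auto simp: D_def)
      also have "\<dots> \<le> v" unfolding v_def f_def using that by (intro Max_ge) auto
      finally show ?thesis .
    qed
    show "v \<le> (\<Sum>b\<in>B. M a b * pmf q b)" if "a \<in> A" for a
    proof -
      have "g b (axis a 1) = M a b" for b
        by (simp add: g_def axis_def if_distrib cong: if_cong)
      then have "(\<chi> b. M a b) \<in> C" using vertex[OF that] by (auto simp: C_def image_iff vec_eq_iff intro!: bexI[of _ "axis a 1"])
      from zC[OF this] have "\<beta> \<le> (\<Sum>b\<in>UNIV. z $ b * M a b)" by (simp add: inner_vec_def)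
      also have "\<dots> = (\<Sum>b\<in>B. z $ b * M a b)"
        using outside by (intro sum.mono_neutral_right) auto
      also have "\<dots> = s * (\<Sum>b\<in>B. M a b * pmf q b)"
        using \<open>s > 0\<close> by (simp add: q sum_distrib_left mult.commute)
      finally show ?thesis using \<open>s * v \<le> \<beta>\<close> \<open>s > 0\<close> by (smt (verit) mult_le_cancel_left_pos)
    qed
  qed
qed

section \<open>The one-step operator\<close>

definition one_step :: "('e::finite, 'a::finite, 'b::finite) game \<Rightarrow> ('e \<Rightarrow> real) \<Rightarrow> 'e \<Rightarrow> 'a \<Rightarrow> 'b \<Rightarrow> real" where
  "one_step G h i a b = exp (theta G * cost G i a b) * (\<Sum>j\<in>UNIV. pmf (trans_law G i a b) j * h j)"

lemma opLw_one_step: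
  "opLw G \<mu> \<nu> h i = (\<Sum>a\<in>actA G i. \<Sum>b\<in>actB G i. one_step G h i a b * \<mu> a * \<nu> b)"
  by (simp add: opLw_def one_step_def sum_distrib_left sum_distrib_right mult_ac)

lemma opLw_diff: "opLw G \<mu> \<nu> h i - opLw G \<mu> \<nu> g i = opLw G \<mu> \<nu> (\<lambda>j. h j - g j) i"
  by (simp add: opLw_def algebra_simps sum_subtractf)

lemma opLw_scale: "opLw G \<mu> \<nu> (\<lambda>j. c * h j) i = c * opLw G \<mu> \<nu> h i"
  by (simp add: opLw_def sum_distrib_left mult_ac)

lemma sum_pmf_mult_le:
  assumes "set_pmf p \<subseteq> A" "finite A" "\<And>x. x \<in> A \<Longrightarrow> f x \<le> (C::real)"
  shows "(\<Sum>x\<in>A. f x * pmf p x) \<le> C"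
proof -
  have "(\<Sum>x\<in>A. f x * pmf p x) \<le> (\<Sum>x\<in>A. C * pmf p x)"
    by (intro sum_mono mult_right_mono assms) auto
  also have "\<dots> = C" using assms by (simp add: sum_pmf_eq_1 flip: sum_distrib_left)
  finally show ?thesis .
qed

lemma sum_pmf_mult_ge:
  assumes "set_pmf p \<subseteq> A" "finite A" "\<And>x. x \<in> A \<Longrightarrow> (C::real) \<le> f x"
  shows "C \<le> (\<Sum>x\<in>A. f x * pmf p x)"
  using sum_pmf_mult_le[of p A "\<lambda>x. - f x" "- C"] assms by (simp add: sum_negf)

lemma opLw_le_col:
  assumes "set_pmf \<nu> \<subseteq> actB G i"
    and "\<And>b. b \<in> actB G i \<Longrightarrow> (\<Sum>a\<in>actA G i. one_step G h i a b * \<mu> a) \<le> C"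
  shows "opLw G \<mu> (pmf \<nu>) h i \<le> C"
proof -
  have "opLw G \<mu> (pmf \<nu>) h i = (\<Sum>b\<in>actB G i. (\<Sum>a\<in>actA G i. one_step G h i a b * \<mu> a) * pmf \<nu> b)"
    unfolding opLw_one_step by (subst sum.swap) (simp add: sum_distrib_right)
  also have "\<dots> \<le> C" using assms by (intro sum_pmf_mult_le) auto
  finally show ?thesis .
qed

lemma opLw_ge_row:
  assumes "set_pmf \<mu> \<subseteq> actA G i"
    and "\<And>a. a \<in> actA G i \<Longrightarrow> C \<le> (\<Sum>b\<in>actB G i. one_step G h i a b * \<nu> b)"
  shows "C \<le> opLw G (pmf \<mu>) \<nu> h i"
proof -
  have "opLw G (pmf \<mu>) \<nu> h i = (\<Sum>a\<in>actA G i. (\<Sum>b\<in>actB G i. one_step G h i a b * \<nu> b) * pmf \<mu> a)"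
    unfolding opLw_one_step by (simp add: sum_distrib_left sum_distrib_right mult_ac)
  also have "\<dots> \<ge> C" using assms by (intro sum_pmf_mult_ge) auto
  finally show ?thesis .
qed

lemma opLw_le:
  assumes "set_pmf \<mu> \<subseteq> actA G i" "set_pmf \<nu> \<subseteq> actB G i"
    and "\<And>a b. a \<in> actA G i \<Longrightarrow> b \<in> actB G i \<Longrightarrow> one_step G h i a b \<le> C"
  shows "opLw G (pmf \<mu>) (pmf \<nu>) h i \<le> C"
  using assms by (intro opLw_le_col sum_pmf_mult_le) auto

lemma opLw_ge:
  assumes "set_pmf \<mu> \<subseteq> actA G i" "set_pmf \<nu> \<subseteq> actB G i"
    and "\<And>a b. a \<in> actA G i \<Longrightarrow> b \<in> actB G i \<Longrightarrow> C \<le> one_step G h i a b"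
  shows "C \<le> opLw G (pmf \<mu>) (pmf \<nu>) h i"
  using assms by (intro opLw_ge_row sum_pmf_mult_ge) auto

text \<open>
  The infimum and the supremum in the operator are attained. All further facts on it use
  only this pair of inequalities.
\<close>

lemma opL_saddle:
  assumes G: "is_game G"
  obtains p q where "set_pmf p \<subseteq> actA G i" "set_pmf q \<subseteq> actB G i"
    "\<And>\<nu>. set_pmf \<nu> \<subseteq> actB G i \<Longrightarrow> opLw G (pmf p) (pmf \<nu>) h i \<le> opL G h i"
    "\<And>\<mu>. set_pmf \<mu> \<subseteq> actA G i \<Longrightarrow> opL G h i \<le> opLw G (pmf \<mu>) (pmf q) h i"
proof -
  have ne: "actA G i \<noteq> {}" "actB G i \<noteq> {}" using G by (auto simp: is_game_def)
  obtain v p q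
    where p: "set_pmf p \<subseteq> actA G i" and q: "set_pmf q \<subseteq> actB G i"
      and pv: "\<And>b. b \<in> actB G i \<Longrightarrow> (\<Sum>a\<in>actA G i. one_step G h i a b * pmf p a) \<le> v"
      and qv: "\<And>a. a \<in> actA G i \<Longrightarrow> v \<le> (\<Sum>b\<in>actB G i. one_step G h i a b * pmf q b)"
    by (rule minimax_finite[OF ne, of "one_step G h i"]) (rule that)
  let ?A = "{\<mu>. set_pmf \<mu> \<subseteq> actA G i}" and ?B = "{\<nu>. set_pmf \<nu> \<subseteq> actB G i}"
  let ?S = "\<lambda>\<mu>. SUP \<nu> \<in> ?B. opLw G (pmf \<mu>) (pmf \<nu>) h i"
  have pU: "opLw G (pmf p) (pmf \<nu>) h i \<le> v" if "\<nu> \<in> ?B" for \<nu>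
    using that pv by (intro opLw_le_col) auto
  have qL: "v \<le> opLw G (pmf \<mu>) (pmf q) h i" if "\<mu> \<in> ?A" for \<mu>
    using that qv by (intro opLw_ge_row) auto
  have bdd: "bdd_above ((\<lambda>\<nu>. opLw G (pmf \<mu>) (pmf \<nu>) h i) ` ?B)" if "\<mu> \<in> ?A" for \<mu>
  proof (rule bdd_aboveI2)
    fix \<nu> assume "\<nu> \<in> ?B"
    then show "opLw G (pmf \<mu>) (pmf \<nu>) h i \<le> Max (range (\<lambda>(a, b). one_step G h i a b))"
      using that by (intro opLw_le) (auto intro!: Max_ge)
  qed
  have SL: "v \<le> ?S \<mu>" if "\<mu> \<in> ?A" for \<mu>
    using q by (intro order.trans[OF qL[OF that] cSUP_upper[OF _ bdd[OF that]]]) auto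
  have "?S p \<le> v" using q pU by (intro cSUP_least) auto
  moreover have "opL G h i \<le> ?S p"
    unfolding opL_def using p SL by (intro cINF_lower bdd_belowI2[of _ v]) auto
  moreover have "v \<le> opL G h i"
    unfolding opL_def using p SL by (intro cINF_greatest) auto
  ultimately have "opL G h i = v" by simp
  then show thesis using that[OF p q] pU qL by auto
qed

text \<open>
  Playing the minimizer for \<open>g\<close> against the maximizer for \<open>h\<close> bounds the difference of the two
  min-max values by a single application of the linear operator to \<open>h - g\<close>.
\<close>

lemma opL_diff_le:
  assumes G: "is_game G"
    and C: "\<And>a b. a \<in> actA G i \<Longrightarrow> b \<in> actB G i \<Longrightarrow> one_step G (\<lambda>j. h j - g j) i a b \<le> C"
  shows "opL G h i - opL G g i \<le> C"
proof -
  obtain p where p: "set_pmf p \<subseteq> actA G i"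
    "\<And>\<nu>. set_pmf \<nu> \<subseteq> actB G i \<Longrightarrow> opLw G (pmf p) (pmf \<nu>) g i \<le> opL G g i"
    using opL_saddle[OF G] by metis
  obtain q where q: "set_pmf q \<subseteq> actB G i"
    "\<And>\<mu>. set_pmf \<mu> \<subseteq> actA G i \<Longrightarrow> opL G h i \<le> opLw G (pmf \<mu>) (pmf q) h i"
    using opL_saddle[OF G] by metis
  have "opL G h i - opL G g i \<le> opLw G (pmf p) (pmf q) h i - opLw G (pmf p) (pmf q) g i"
    using p q by (simp add: diff_mono)
  also have "\<dots> \<le> C" unfolding opLw_diff using p q C by (intro opLw_le) auto
  finally show ?thesis .
qed

lemma one_step_mono:
  assumes "\<And>j. h j \<le> g j"
  shows "one_step G h i a b \<le> one_step G g i a b"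
  unfolding one_step_def by (intro mult_left_mono sum_mono assms) auto

lemma opL_mono:
  assumes G: "is_game G" and "\<And>j. h j \<le> g j"
  shows "opL G h i \<le> opL G g i"
proof -
  have "one_step G (\<lambda>j. h j - g j) i a b \<le> 0" for a b
    using one_step_mono[of "\<lambda>j. h j - g j" "\<lambda>_. 0" G i a b] assms by (simp add: one_step_def)
  then show ?thesis using opL_diff_le[OF G, of i h g 0] by simp
qed

lemma opL_scale:
  assumes G: "is_game G" and c: "0 \<le> c"
  shows "opL G (\<lambda>j. c * h j) i = c * opL G h i"
proof -
  obtain p q where 1: "set_pmf p \<subseteq> actA G i" "set_pmf q \<subseteq> actB G i"
    "\<And>\<nu>. set_pmf \<nu> \<subseteq> actB G i \<Longrightarrow> opLw G (pmf p) (pmf \<nu>) h i \<le> opL G h i"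
    "\<And>\<mu>. set_pmf \<mu> \<subseteq> actA G i \<Longrightarrow> opL G h i \<le> opLw G (pmf \<mu>) (pmf q) h i"
    by (rule opL_saddle[OF G, of i h]) (rule that)
  obtain p' q' where 2: "set_pmf p' \<subseteq> actA G i" "set_pmf q' \<subseteq> actB G i"
    "\<And>\<nu>. set_pmf \<nu> \<subseteq> actB G i \<Longrightarrow> opLw G (pmf p') (pmf \<nu>) (\<lambda>j. c * h j) i \<le> opL G (\<lambda>j. c * h j) i"
    "\<And>\<mu>. set_pmf \<mu> \<subseteq> actA G i \<Longrightarrow> opL G (\<lambda>j. c * h j) i \<le> opLw G (pmf \<mu>) (pmf q') (\<lambda>j. c * h j) i"
    by (rule opL_saddle[OF G, of i "\<lambda>j. c * h j"]) (rule that)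
  have "opL G (\<lambda>j. c * h j) i \<le> c * opLw G (pmf p) (pmf q') h i"
    using 1 2 by (simp add: opLw_scale)
  also have "\<dots> \<le> c * opL G h i" using 1 2 c by (simp add: mult_left_mono)
  finally have "opL G (\<lambda>j. c * h j) i \<le> c * opL G h i" .
  moreover have "c * opL G h i \<le> c * opLw G (pmf p') (pmf q) h i"
    using 1 2 c by (simp add: mult_left_mono)
  moreover have "\<dots> \<le> opL G (\<lambda>j. c * h j) i" using 1 2 by (simp flip: opLw_scale)
  ultimately show ?thesis by simp
qed

lemma opL_le:
  assumes G: "is_game G"
    and C: "\<And>a b. a \<in> actA G i \<Longrightarrow> b \<in> actB G i \<Longrightarrow> one_step G h i a b \<le> C"
  shows "opL G h i \<le> C"
  using opL_diff_le[OF G, of i h "\<lambda>_. 0" C] opL_scale[OF G, of 0 "\<lambda>_. 0" i] C by simp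

lemma opL_ge:
  assumes G: "is_game G"
    and C: "\<And>a b. a \<in> actA G i \<Longrightarrow> b \<in> actB G i \<Longrightarrow> C \<le> one_step G h i a b"
  shows "C \<le> opL G h i"
proof -
  obtain p q where "set_pmf p \<subseteq> actA G i" "set_pmf q \<subseteq> actB G i"
    "opLw G (pmf p) (pmf q) h i \<le> opL G h i"
    by (rule opL_saddle[OF G, of i h]) blast
  then show ?thesis using opLw_ge[of p G i q C h] C by auto
qed

section \<open>Expectations of products along the controlled process\<close>

text \<open>
  The continuation of a policy after the triple \<open>t\<close>; shifted policies make it possible to analyse the process by its first step.
\<close>

definition shift_policy :: "'e \<times> 'a \<times> 'b \<Rightarrow> ('e, 'a, 'b, 'c) policy \<Rightarrow> ('e, 'a, 'b, 'c) policy" where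
  "shift_policy t \<pi> = (\<lambda>hs. \<pi> (t # hs))"

primrec path_weight :: "('e::finite, 'a::finite, 'b::finite) game \<Rightarrow> 'e pmf \<Rightarrow>
    ('e, 'a, 'b, 'a) policy \<Rightarrow> ('e, 'a, 'b, 'b) policy \<Rightarrow> ('e \<times> 'a \<times> 'b) list \<Rightarrow> real" where
  "path_weight G p \<pi> \<sigma> [] = 1"
| "path_weight G p \<pi> \<sigma> (t # xs) = (case t of (x, a, b) \<Rightarrow>
     pmf p x * pmf (\<pi> [] x) a * pmf (\<sigma> [] x) b *
     path_weight G (trans_law G x a b) (shift_policy t \<pi>) (shift_policy t \<sigma>) xs)"

lemma path_weight_nonneg: "0 \<le> path_weight G p \<pi> \<sigma> xs"
  by (induction xs arbitrary: p \<pi> \<sigma>) (auto split: prod.split)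

lemma pmf_step_law:
  "pmf (step_law G i \<pi> \<sigma> n \<omega>) (x, a, b) =
     pmf (case n of 0 \<Rightarrow> return_pmf i | Suc m \<Rightarrow> (case \<omega> m of (x, a, b) \<Rightarrow> trans_law G x a b)) x *
     pmf (\<pi> (map \<omega> [0..<n]) x) a * pmf (\<sigma> (map \<omega> [0..<n]) x) b"
  (is "_ = pmf ?N x * _ * _")
proof -
  have "pmf (map_pmf (Pair y) (pair_pmf (\<pi> (map \<omega> [0..<n]) y) (\<sigma> (map \<omega> [0..<n]) y))) (x, a, b) =
      (if y = x then pmf (\<pi> (map \<omega> [0..<n]) x) a * pmf (\<sigma> (map \<omega> [0..<n]) x) b else 0)" for y
  proof (cases "y = x")
    case True
    then show ?thesis
      using pmf_map_inj'[of "Pair x" "pair_pmf (\<pi> (map \<omega> [0..<n]) x) (\<sigma> (map \<omega> [0..<n]) x)" "(a, b)"]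
      by (simp add: pmf_pair inj_on_def)
  qed (auto simp: pmf_eq_0_set_pmf)
  then show ?thesis
    unfolding step_law_def pmf_bind
    by (subst integral_measure_pmf_real[of UNIV])
       (auto simp: if_distrib[of "\<lambda>z. z * _"] cong: if_cong)
qed

lemma prod_step_eq_path_weight:
  "(\<Prod>k<length xs. case xs ! k of (x, a, b) \<Rightarrow>
      pmf (case k of 0 \<Rightarrow> p | Suc m \<Rightarrow> (case xs ! m of (x, a, b) \<Rightarrow> trans_law G x a b)) x *
      pmf (\<pi> (take k xs) x) a * pmf (\<sigma> (take k xs) x) b) = path_weight G p \<pi> \<sigma> xs"
proof (induction xs arbitrary: p \<pi> \<sigma>)
  case (Cons t xs)
  obtain x a b where t: "t = (x, a, b)" by (cases t)
  have "(\<Prod>k<length xs. case xs ! k of (y, c, d) \<Rightarrow>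
      pmf (case (t # xs) ! k of (x, a, b) \<Rightarrow> trans_law G x a b) y *
      pmf (\<pi> (t # take k xs) y) c * pmf (\<sigma> (t # take k xs) y) d) =
    (\<Prod>k<length xs. case xs ! k of (y, c, d) \<Rightarrow>
      pmf (case k of 0 \<Rightarrow> trans_law G x a b | Suc m \<Rightarrow> (case xs ! m of (x, a, b) \<Rightarrow> trans_law G x a b)) y *
      pmf (shift_policy t \<pi> (take k xs) y) c * pmf (shift_policy t \<sigma> (take k xs) y) d)"
    by (intro prod.cong) (auto simp: shift_policy_def t split: nat.split)
  then show ?case
    by (simp add: prod.lessThan_Suc_shift Cons.IH[symmetric] t del: prod.lessThan_Suc)
qed simp

lemma space_path_measure: "space (path_measure G i \<pi> \<sigma>) = UNIV"
  using sets_eq_imp_space_eq[OF sets_path_measure] by (simp add: space_PiM)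

lemma measurable_prefix: "{\<omega>. map \<omega> [0..<n] \<in> X} \<in> sets (path_measure G i \<pi> \<sigma>)"
proof -
  have *: "{\<omega>. map \<omega> [0..<n] = xs} \<in> sets (path_measure G i \<pi> \<sigma>)" for xs
  proof (cases "length xs = n")
    case True
    then have "{\<omega>. map \<omega> [0..<n] = xs} = {\<omega>. \<forall>k<n. \<omega> k = xs ! k}"
      by (auto simp: list_eq_iff_nth_eq)
    also have "\<dots> = prod_emb UNIV (\<lambda>_. count_space UNIV) {..<n} (PiE {..<n} (\<lambda>k. {xs ! k}))"
      by (auto simp: prod_emb_def PiE_def Pi_def restrict_def extensional_def)
    also have "\<dots> \<in> sets (path_measure G i \<pi> \<sigma>)"
      unfolding sets_path_measure by (intro sets_PiM_I) auto
    finally show ?thesis .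
  next
    case False
    then have "{\<omega>. map \<omega> [0..<n] = xs} = {}" by auto
    then show ?thesis by simp
  qed
  have "finite {xs :: ('a \<times> 'b \<times> 'c) list. length xs = n}"
    using finite_lists_length_eq[of "UNIV :: ('a \<times> 'b \<times> 'c) set" n] by simp
  then have "(\<Union>xs\<in>X \<inter> {xs. length xs = n}. {\<omega>. map \<omega> [0..<n] = xs}) \<in> sets (path_measure G i \<pi> \<sigma>)"
    by (intro sets.finite_UN *) auto
  also have "(\<Union>xs\<in>X \<inter> {xs. length xs = n}. {\<omega>. map \<omega> [0..<n] = xs}) = {\<omega>. map \<omega> [0..<n] \<in> X}"
    by auto
  finally show ?thesis .
qed

lemma measure_prefix:
  assumes "length xs = n"
  shows "measure (path_measure G i \<pi> \<sigma>) {\<omega>. map \<omega> [0..<n] = xs} = path_weight G (return_pmf i) \<pi> \<sigma> xs"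
proof -
  have "{\<omega>. map \<omega> [0..<n] = xs} = {\<omega>. \<forall>k<n. \<omega> k = xs ! k}"
    using assms by (auto simp: list_eq_iff_nth_eq)
  moreover have "(\<Prod>k<n. pmf (step_law G i \<pi> \<sigma> k (nth xs)) (xs ! k)) = path_weight G (return_pmf i) \<pi> \<sigma> xs"
    unfolding prod_step_eq_path_weight[symmetric] assms
  proof (intro prod.cong refl)
    fix k assume "k \<in> {..<n}"
    then have "map ((!) xs) [0..<k] = take k xs" using assms by (auto simp: list_eq_iff_nth_eq)
    then show "pmf (step_law G i \<pi> \<sigma> k ((!) xs)) (xs ! k) = (case xs ! k of (x, a, b) \<Rightarrow>
      pmf (case k of 0 \<Rightarrow> return_pmf i | Suc m \<Rightarrow> (case xs ! m of (x, a, b) \<Rightarrow> trans_law G x a b)) x *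
      pmf (\<pi> (take k xs) x) a * pmf (\<sigma> (take k xs) x) b)"
      by (cases "xs ! k") (simp add: pmf_step_law)
  qed
  ultimately show ?thesis
    by (simp add: measure_def emeasure_path_cylinder prod_ennreal prod_nonneg path_weight_nonneg)
qed

lemma integral_prefix:
  "(\<integral>\<omega>. f (map \<omega> [0..<n]) \<partial>path_measure G i \<pi> \<sigma>) =
     (\<Sum>xs | length xs = n. f xs * path_weight G (return_pmf i) \<pi> \<sigma> xs :: real)"
proof -
  interpret prob_space "path_measure G i \<pi> \<sigma>" by (rule prob_space_path_measure)
  have fin: "finite {xs :: ('a \<times> 'b \<times> 'c) list. length xs = n}"
    using finite_lists_length_eq[of "UNIV :: ('a \<times> 'b \<times> 'c) set" n] by simp
  have meas: "{\<omega>. map \<omega> [0..<n] = xs} \<in> sets (path_measure G i \<pi> \<sigma>)" for xs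
    using measurable_prefix[of n "{xs}"] by simp
  have "f (map \<omega> [0..<n]) = (\<Sum>xs | length xs = n. f xs * indicator {\<omega>. map \<omega> [0..<n] = xs} \<omega>)" for \<omega> :: "nat \<Rightarrow> _"
    using fin by (subst sum.remove[of _ "map \<omega> [0..<n]"]) (auto simp: indicator_def intro!: sum.neutral)
  then have "(\<integral>\<omega>. f (map \<omega> [0..<n]) \<partial>path_measure G i \<pi> \<sigma>) =
      (\<integral>\<omega>. (\<Sum>xs | length xs = n. f xs * indicator {\<omega>. map \<omega> [0..<n] = xs} \<omega>) \<partial>path_measure G i \<pi> \<sigma>)"
    by presburger
  also have "\<dots> = (\<Sum>xs | length xs = n. f xs * measure (path_measure G i \<pi> \<sigma>) {\<omega>. map \<omega> [0..<n] = xs})"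
    using meas
    by (subst Bochner_Integration.integral_sum)
       (auto intro!: integrable_mult_right integrable_real_indicator simp: emeasure_eq_measure)
  also have "\<dots> = (\<Sum>xs | length xs = n. f xs * path_weight G (return_pmf i) \<pi> \<sigma> xs)"
    by (intro sum.cong) (auto simp: measure_prefix)
  finally show ?thesis .
qed

text \<open>
  The expectation of the product of \<open>u\<close> over the first \<open>n\<close> triples when the initial state has law \<open>p\<close>,
  in the recursive form given by conditioning on the first triple. Taking \<open>u\<close> to be the exponential cost or
  the indicator of avoiding a state yields the two functionals needed below.
\<close>

primrec expect_prod :: "('e::finite, 'a::finite, 'b::finite) game \<Rightarrow> ('e \<times> 'a \<times> 'b \<Rightarrow> real) \<Rightarrow> nat \<Rightarrow>
    'e pmf \<Rightarrow> ('e, 'a, 'b, 'a) policy \<Rightarrow> ('e, 'a, 'b, 'b) policy \<Rightarrow> real" where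
  "expect_prod G u 0 = (\<lambda>p \<pi> \<sigma>. 1 :: real)"
| "expect_prod G u (Suc n) = (\<lambda>p \<pi> \<sigma>. \<Sum>x\<in>UNIV. \<Sum>a\<in>UNIV. \<Sum>b\<in>UNIV.
     pmf p x * pmf (\<pi> [] x) a * pmf (\<sigma> [] x) b * u (x, a, b) *
     expect_prod G u n (trans_law G x a b) (shift_policy (x, a, b) \<pi>) (shift_policy (x, a, b) \<sigma>))"

lemma sum_lists_Suc:
  fixes f :: "'t::finite list \<Rightarrow> real"
  shows "(\<Sum>xs | length xs = Suc n. f xs) = (\<Sum>t\<in>UNIV. \<Sum>xs | length xs = n. f (t # xs))"
proof -
  have "xs \<in> (\<lambda>(t, xs). t # xs) ` (UNIV \<times> {xs. length xs = n}) \<longleftrightarrow> length xs = Suc n" for xs :: "'t list"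
    by (cases xs) auto
  then have "{xs :: 't list. length xs = Suc n} = (\<lambda>(t, xs). t # xs) ` (UNIV \<times> {xs. length xs = n})"
    by blast
  moreover have "inj_on (\<lambda>(t :: 't, xs). t # xs) (UNIV \<times> {xs. length xs = n})"
    by (auto simp: inj_on_def)
  ultimately show ?thesis
    by (simp add: sum.reindex sum.cartesian_product case_prod_unfold)
qed

lemma sum_path_weight_expect_prod:
  "(\<Sum>xs | length xs = n. prod_list (map u xs) * path_weight G p \<pi> \<sigma> xs) = expect_prod G u n p \<pi> \<sigma>"
proof (induction n arbitrary: p \<pi> \<sigma>)
  case (Suc n)
  have "(\<Sum>xs | length xs = Suc n. prod_list (map u xs) * path_weight G p \<pi> \<sigma> xs) =
     (\<Sum>t\<in>UNIV. case t of (x, a, b) \<Rightarrow> pmf p x * pmf (\<pi> [] x) a * pmf (\<sigma> [] x) b * u t *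
        expect_prod G u n (trans_law G x a b) (shift_policy t \<pi>) (shift_policy t \<sigma>))"
    unfolding sum_lists_Suc
  proof (intro sum.cong refl)
    fix t :: "'a \<times> 'b \<times> 'c"
    obtain x a b where t: "t = (x, a, b)" by (cases t)
    show "(\<Sum>xs | length xs = n. prod_list (map u (t # xs)) * path_weight G p \<pi> \<sigma> (t # xs)) =
      (case t of (x, a, b) \<Rightarrow> pmf p x * pmf (\<pi> [] x) a * pmf (\<sigma> [] x) b * u t *
        expect_prod G u n (trans_law G x a b) (shift_policy t \<pi>) (shift_policy t \<sigma>))"
      unfolding t by (simp add: Suc.IH[symmetric] sum_distrib_left mult_ac)
  qed
  also have "\<dots> = expect_prod G u (Suc n) p \<pi> \<sigma>"
    by (simp add: sum.cartesian_product UNIV_Times_UNIV[symmetric] case_prod_unfold del: UNIV_Times_UNIV)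
  finally show ?case .
qed simp

lemma integral_prod_expect_prod:
  "(\<integral>\<omega>. (\<Prod>k<n. u (\<omega> k)) \<partial>path_measure G i \<pi> \<sigma>) = expect_prod G u n (return_pmf i) \<pi> \<sigma>"
proof -
  have "(\<Prod>k<n. u (\<omega> k)) = prod_list (map u (map \<omega> [0..<n]))" for \<omega> :: "nat \<Rightarrow> _"
    by (simp add: prod.list_conv_set_nth atLeast0LessThan)
  then show ?thesis using integral_prefix[where f = "\<lambda>xs. prod_list (map u xs)"]
    by (simp add: sum_path_weight_expect_prod)
qed

section \<open>Worst-case probability of avoiding a state\<close>

text \<open>
  The largest probability, over all pairs of policies, that the chain started in \<open>i\<close> is not in \<open>j\<close>
  at any of the times \<open>0, \<dots>, n\<close>, given by its dynamic programming equation.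
\<close>

primrec max_avoid :: "('e::finite, 'a::finite, 'b::finite) game \<Rightarrow> 'e \<Rightarrow> nat \<Rightarrow> 'e \<Rightarrow> real" where
  "max_avoid G j 0 = (\<lambda>i. if i = j then 0 else 1)"
| "max_avoid G j (Suc n) = (\<lambda>i. if i = j then 0 else
     MAX (a, b) \<in> actA G i \<times> actB G i. \<Sum>y\<in>UNIV. pmf (trans_law G i a b) y * max_avoid G j n y)"

lemma max_avoid_self [simp]: "max_avoid G j n j = 0"
  by (cases n) auto

lemma max_avoid_ge:
  assumes "i \<noteq> j" "a \<in> actA G i" "b \<in> actB G i"
  shows "(\<Sum>y\<in>UNIV. pmf (trans_law G i a b) y * max_avoid G j n y) \<le> max_avoid G j (Suc n) i"
  using assms by (auto intro!: Max_ge)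

lemma max_avoid_attained:
  assumes G: "is_game G"
  obtains f g where
    "\<And>n i. f n i \<in> actA G i" "\<And>n i. g n i \<in> actB G i"
    "\<And>n i. i \<noteq> j \<Longrightarrow> max_avoid G j (Suc n) i =
       (\<Sum>y\<in>UNIV. pmf (trans_law G i (f n i) (g n i)) y * max_avoid G j n y)"
proof -
  let ?q = "\<lambda>n i. \<lambda>(a, b). \<Sum>y\<in>UNIV. pmf (trans_law G i a b) y * max_avoid G j n y"
  have "\<exists>c \<in> actA G i \<times> actB G i. i \<noteq> j \<longrightarrow> max_avoid G j (Suc n) i = ?q n i c" for n i
  proof -
    have "actA G i \<times> actB G i \<noteq> {}" using G by (auto simp: is_game_def)
    then have "Max (?q n i ` (actA G i \<times> actB G i)) \<in> ?q n i ` (actA G i \<times> actB G i)"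
      by (intro Max_in) auto
    then show ?thesis by auto
  qed
  then have "\<exists>c. c \<in> actA G i \<times> actB G i \<and> (i \<noteq> j \<longrightarrow> max_avoid G j (Suc n) i = ?q n i c)" for n i
    by blast
  note some = someI_ex[OF this]
  define c where "c = (\<lambda>n i. SOME c. c \<in> actA G i \<times> actB G i \<and>
    (i \<noteq> j \<longrightarrow> max_avoid G j (Suc n) i = ?q n i c))"
  have c: "c n i \<in> actA G i \<times> actB G i" "i \<noteq> j \<Longrightarrow> max_avoid G j (Suc n) i = ?q n i (c n i)" for n i
    using some[of i n] unfolding c_def by blast+
  show thesis
  proof (rule that[of "\<lambda>n i. fst (c n i)" "\<lambda>n i. snd (c n i)"])
    show "fst (c n i) \<in> actA G i" "snd (c n i) \<in> actB G i" for n i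
      using c(1)[of n i] by (auto simp: mem_Times_iff)
  qed (simp_all add: c(2) case_prod_unfold del: max_avoid.simps)
qed

text \<open>
  The rule \<open>f k\<close> is meant for \<open>k + 1\<close> remaining transitions, so the policy uses \<open>f (n - 1)\<close>, \<open>f (n - 2)\<close>
  and so on down to \<open>f 0\<close>, at which truncated subtraction keeps it from then on.
\<close>

definition countdown_policy :: "(nat \<Rightarrow> 'e \<Rightarrow> 'c) \<Rightarrow> nat \<Rightarrow> ('e, 'a, 'b, 'c) policy" where
  "countdown_policy f n = (\<lambda>hs i. return_pmf (f (n - Suc (length hs)) i))"

lemma shift_countdown_policy [simp]:
  "shift_policy t (countdown_policy f (Suc n)) = countdown_policy f n"
  by (simp add: shift_policy_def countdown_policy_def)

lemma sum_return_pmf_pair: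
  fixes F :: "'a::finite \<Rightarrow> 'b::finite \<Rightarrow> real"
  shows "(\<Sum>a\<in>UNIV. \<Sum>b\<in>UNIV. c * pmf (return_pmf a\<^sub>0) a * pmf (return_pmf b\<^sub>0) b * r * F a b) = c * r * F a\<^sub>0 b\<^sub>0"
proof -
  have "(\<Sum>b\<in>UNIV. c * pmf (return_pmf a\<^sub>0) a * pmf (return_pmf b\<^sub>0) b * r * F a b) =
      (if a = a\<^sub>0 then c * r * F a b\<^sub>0 else 0)" for a
    by (subst sum.remove[of _ b\<^sub>0]) (auto simp: pmf_return indicator_def intro!: sum.neutral)
  then show ?thesis by simp
qed

text \<open>
  The maximizing rules attain the dynamic programming bound. The index is shifted because \<open>n\<close>
  transitions visit \<open>n + 1\<close> states.
\<close>

lemma expect_prod_countdown: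
  assumes "\<And>n i. i \<noteq> j \<Longrightarrow> max_avoid G j (Suc n) i =
       (\<Sum>y\<in>UNIV. pmf (trans_law G i (f n i) (g n i)) y * max_avoid G j n y)"
  shows "expect_prod G (\<lambda>(x, a, b). if x = j then 0 else 1) (Suc n) p (countdown_policy f n) (countdown_policy g n) =
    (\<Sum>x\<in>UNIV. pmf p x * max_avoid G j n x)"
proof (induction n arbitrary: p)
  case 0
  have "expect_prod G (\<lambda>(x, a, b). if x = j then 0 else 1) (Suc 0) p (countdown_policy f 0) (countdown_policy g 0) =
    (\<Sum>x\<in>UNIV. pmf p x * (if x = j then 0 else 1) * 1)"
    unfolding expect_prod.simps split countdown_policy_def
    by (subst sum_return_pmf_pair) simp
  then show ?case by simp
next
  case (Suc n)
  let ?u = "\<lambda>(x, a, b). if x = j then 0 else 1"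
  have "expect_prod G ?u (Suc (Suc n)) p (countdown_policy f (Suc n)) (countdown_policy g (Suc n)) =
    (\<Sum>x\<in>UNIV. pmf p x * (if x = j then 0 else 1) *
       (\<Sum>y\<in>UNIV. pmf (trans_law G x (f n x) (g n x)) y * max_avoid G j n y))"
    unfolding expect_prod.simps(2)[of G ?u "Suc n"] shift_countdown_policy Suc.IH split
    unfolding countdown_policy_def by (subst sum_return_pmf_pair) simp
  also have "\<dots> = (\<Sum>x\<in>UNIV. pmf p x * max_avoid G j (Suc n) x)"
    using assms[of _ n] by (intro sum.cong) (auto simp del: max_avoid.simps)
  finally show ?case .
qed

lemma hitting_time_le_iff: "hitting_time j \<omega> \<le> enat n \<longleftrightarrow> (\<exists>k. 0 < k \<and> k \<le> n \<and> fst (\<omega> k) = j)"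
proof
  assume le: "hitting_time j \<omega> \<le> enat n"
  let ?S = "{enat n | n. n > 0 \<and> state_at n \<omega> = j}"
  have "?S \<noteq> {}"
  proof
    assume "?S = {}"
    with le show False unfolding hitting_time_def by (simp only: Inf_empty) (simp add: top_enat_def)
  qed
  then obtain m where "m \<in> ?S" by blast
  then have "Inf ?S \<in> ?S" by (rule wellorder_InfI)
  then have "hitting_time j \<omega> \<in> ?S" by (simp only: hitting_time_def)
  then show "\<exists>k. 0 < k \<and> k \<le> n \<and> fst (\<omega> k) = j"
    using le by (auto simp: state_at_def)
next
  assume "\<exists>k. 0 < k \<and> k \<le> n \<and> fst (\<omega> k) = j"
  then obtain k where "0 < k" "k \<le> n" "fst (\<omega> k) = j" by auto
  then have "hitting_time j \<omega> \<le> enat k"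
    unfolding hitting_time_def by (intro Inf_lower) (auto simp: state_at_def)
  then show "hitting_time j \<omega> \<le> enat n" using \<open>k \<le> n\<close> by (metis enat_ord_simps(1) order.trans)
qed

lemma policies_nonempty:
  assumes "is_game G"
  shows "policies1 G \<noteq> {}" "policies2 G \<noteq> {}"
proof -
  have "(\<lambda>hs i. return_pmf (SOME a. a \<in> actA G i)) \<in> policies1 G"
    "(\<lambda>hs i. return_pmf (SOME a. a \<in> actB G i)) \<in> policies2 G"
    using assms by (auto simp: policies1_def policies2_def is_game_def some_in_eq)
  then show "policies1 G \<noteq> {}" "policies2 G \<noteq> {}" by auto
qed

lemma irreducibility_coeff_le:
  fixes G :: "('e::finite, 'a::finite, 'b::finite) game"
  assumes G: "is_game G" and p: "\<pi> \<in> policies1 G" "\<sigma> \<in> policies2 G"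
  shows "irreducibility_coeff G \<le>
    measure (path_measure G i \<pi> \<sigma>) {\<omega>. hitting_time j \<omega> \<le> enat CARD('e)}"
proof -
  let ?m = "\<lambda>i j \<pi> \<sigma>. measure (path_measure G i \<pi> \<sigma>) {\<omega>. hitting_time j \<omega> \<le> enat CARD('e)}"
  have "irreducibility_coeff G \<le> (INF \<pi> \<in> policies1 G. INF \<sigma> \<in> policies2 G. ?m i j \<pi> \<sigma>)"
    unfolding irreducibility_coeff_def by (rule Min_le) (auto intro: rev_image_eqI[of "(i, j)"])
  also have "\<dots> \<le> (INF \<sigma> \<in> policies2 G. ?m i j \<pi> \<sigma>)"
    using p policies_nonempty[OF G]
    by (intro cINF_lower bdd_belowI2[of _ 0] cINF_greatest) auto
  also have "\<dots> \<le> ?m i j \<pi> \<sigma>"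
    using p by (intro cINF_lower bdd_belowI2[of _ 0]) auto
  finally show ?thesis .
qed

lemma irreducibility_coeff_le_1:
  assumes G: "is_game G"
  shows "irreducibility_coeff G \<le> 1"
proof -
  obtain \<pi> \<sigma> where "\<pi> \<in> policies1 G" "\<sigma> \<in> policies2 G" using policies_nonempty[OF G] by blast
  from irreducibility_coeff_le[OF G this] show ?thesis
    using prob_space.prob_le_1[OF prob_space_path_measure] order.trans by blast
qed

text \<open>
  The irreducibility coefficient is an infimum over all policies, in particular a bound for the
  avoiding ones. Not visiting \<open>j\<close> at the times \<open>0, \<dots>, d\<close> is contained in the event that the hitting time
  exceeds \<open>d\<close>, so an inclusion suffices although the hitting time ignores time \<open>0\<close>.
\<close>

lemma max_avoid_le:
  fixes G :: "('e::finite, 'a::finite, 'b::finite) game"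
  assumes G: "is_game G"
  shows "max_avoid G j CARD('e) i \<le> 1 - irreducibility_coeff G"
proof (cases "i = j")
  case True
  then show ?thesis using irreducibility_coeff_le_1[OF G] by simp
next
  case False
  let ?d = "CARD('e)"
  obtain f g where fg: "\<And>n i. f n i \<in> actA G i" "\<And>n i. g n i \<in> actB G i"
    "\<And>n i. i \<noteq> j \<Longrightarrow> max_avoid G j (Suc n) i =
       (\<Sum>y\<in>UNIV. pmf (trans_law G i (f n i) (g n i)) y * max_avoid G j n y)"
    by (rule max_avoid_attained[OF G, of j]) (rule that)
  let ?\<pi> = "countdown_policy f ?d" and ?\<sigma> = "countdown_policy g ?d"
  let ?P = "path_measure G i ?\<pi> ?\<sigma>"
  interpret prob_space ?P by (rule prob_space_path_measure)
  have pol: "?\<pi> \<in> policies1 G" "?\<sigma> \<in> policies2 G"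
    using fg by (auto simp: policies1_def policies2_def countdown_policy_def)
  define S where "S = {\<omega> :: nat \<Rightarrow> 'e \<times> 'a \<times> 'b. \<forall>k<Suc ?d. fst (\<omega> k) \<noteq> j}"
  have S_prefix: "S = {\<omega>. map \<omega> [0..<Suc ?d] \<in> {xs. \<forall>t\<in>set xs. fst t \<noteq> j}}"
    by (auto simp: S_def simp del: upt_Suc)
  have S: "S \<in> events" unfolding S_prefix by (rule measurable_prefix)
  have "max_avoid G j ?d i = (\<Sum>x\<in>UNIV. pmf (return_pmf i) x * max_avoid G j ?d x)"
    by (subst sum.remove[of _ i]) (auto simp: pmf_return intro!: sum.neutral)
  also have "\<dots> = (\<integral>\<omega>. (\<Prod>k<Suc ?d. (case \<omega> k of (x, a, b) \<Rightarrow> if x = j then 0 else 1)) \<partial>?P)"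
    unfolding integral_prod_expect_prod[where u = "\<lambda>(x, a, b). if x = j then 0 else 1"]
    by (rule expect_prod_countdown[symmetric]) (rule fg)
  also have "\<dots> = (\<integral>\<omega>. indicator S \<omega> \<partial>?P)"
  proof (intro Bochner_Integration.integral_cong refl)
    fix \<omega> :: "nat \<Rightarrow> 'e \<times> 'a \<times> 'b"
    show "(\<Prod>k<Suc ?d. (case \<omega> k of (x, a, b) \<Rightarrow> if x = j then 0 else 1)) = (indicator S \<omega> :: real)"
    proof (cases "\<omega> \<in> S")
      case True
      then show ?thesis by (auto simp: S_def case_prod_unfold simp del: prod.lessThan_Suc intro!: prod.neutral)
    next
      case False
      then show ?thesis
        by (auto simp: S_def case_prod_unfold simp del: prod.lessThan_Suc intro!: prod_zero)
    qed
  qed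
  also have "\<dots> = prob S" using S by simp
  also have "\<dots> = 1 - prob (space ?P - S)" using S by (simp add: prob_compl)
  also have "\<dots> \<le> 1 - prob {\<omega>. hitting_time j \<omega> \<le> enat ?d}"
  proof -
    have "{\<omega>. hitting_time j \<omega> \<le> enat ?d} \<subseteq> space ?P - S"
      by (auto simp: hitting_time_le_iff S_def space_path_measure less_Suc_eq_le)
    then show ?thesis using S by (intro diff_left_mono finite_measure_mono) auto
  qed
  also have "\<dots> \<le> 1 - irreducibility_coeff G"
    using irreducibility_coeff_le[OF G pol] by simp
  finally show ?thesis .
qed

section \<open>Positive eigenfunctions and the taboo iteration\<close>

definition cost_max :: "('e::finite, 'a::finite, 'b::finite) game \<Rightarrow> real" where
  "cost_max G = (MAX (i, a, b) \<in> admissible G. cost G i a b)"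

definition cost_min :: "('e::finite, 'a::finite, 'b::finite) game \<Rightarrow> real" where
  "cost_min G = (MIN (i, a, b) \<in> admissible G. cost G i a b)"

lemma cost_bounds:
  assumes "a \<in> actA G i" "b \<in> actB G i"
  shows "cost_min G \<le> cost G i a b" "cost G i a b \<le> cost_max G"
proof -
  have "(i, a, b) \<in> admissible G" using assms by (simp add: admissible_def)
  then show "cost_min G \<le> cost G i a b" "cost G i a b \<le> cost_max G"
    unfolding cost_min_def cost_max_def by (auto intro!: Min_le Max_ge rev_image_eqI)
qed

lemma sum_pmf_weights_le:
  fixes p :: "'e::finite pmf"
  assumes "\<And>y. g y \<le> (C :: real)"
  shows "(\<Sum>y\<in>UNIV. pmf p y * g y) \<le> C"
  using sum_pmf_mult_le[of p UNIV g C] assms by (simp add: mult.commute)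

lemma sum_pmf_weights_ge:
  fixes p :: "'e::finite pmf"
  assumes "\<And>y. (C :: real) \<le> g y"
  shows "C \<le> (\<Sum>y\<in>UNIV. pmf p y * g y)"
  using sum_pmf_mult_ge[of p UNIV C g] assms by (simp add: mult.commute)

lemma one_step_upper:
  assumes G: "is_game G" and ab: "a \<in> actA G i" "b \<in> actB G i"
    and g: "0 \<le> (\<Sum>y\<in>UNIV. pmf (trans_law G i a b) y * g y)"
  shows "one_step G g i a b \<le> exp (theta G * cost_max G) * (\<Sum>y\<in>UNIV. pmf (trans_law G i a b) y * g y)"
  unfolding one_step_def using G cost_bounds[OF ab] g
  by (intro mult_right_mono) (auto simp: is_game_def)

lemma one_step_lower:
  assumes G: "is_game G" and ab: "a \<in> actA G i" "b \<in> actB G i"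
    and g: "0 \<le> (\<Sum>y\<in>UNIV. pmf (trans_law G i a b) y * g y)"
  shows "exp (theta G * cost_min G) * (\<Sum>y\<in>UNIV. pmf (trans_law G i a b) y * g y) \<le> one_step G g i a b"
  unfolding one_step_def using G cost_bounds[OF ab] g
  by (intro mult_right_mono) (auto simp: is_game_def)

lemma opL_nonneg:
  assumes G: "is_game G" and g: "\<And>y. 0 \<le> g y"
  shows "0 \<le> opL G g i"
  using g by (intro opL_ge[OF G]) (auto simp: one_step_def intro!: mult_nonneg_nonneg sum_nonneg)

text \<open>
  With \<open>s\<close> the inverse of the eigenvalue this is the value of the game in which the normalized exponential cost is
  collected until \<open>j\<close> is reached, and nothing is paid if that takes more than \<open>n\<close> steps.
\<close>

primrec taboo_iter :: "('e::finite, 'a::finite, 'b::finite) game \<Rightarrow> 'e \<Rightarrow> real \<Rightarrow> nat \<Rightarrow> 'e \<Rightarrow> real" where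
  "taboo_iter G j s 0 = (\<lambda>i. if i = j then 1 else 0)"
| "taboo_iter G j s (Suc n) = (\<lambda>i. if i = j then 1 else s * opL G (taboo_iter G j s n) i)"

lemma taboo_iter_self [simp]: "taboo_iter G j s n j = 1"
  by (cases n) auto

lemma taboo_iter_nonneg:
  assumes "is_game G" "0 \<le> s"
  shows "0 \<le> taboo_iter G j s n i"
  by (induction n arbitrary: i) (auto intro!: mult_nonneg_nonneg opL_nonneg assms)

lemma taboo_iter_mono:
  assumes G: "is_game G" and s: "0 \<le> s" and "m \<le> n"
  shows "taboo_iter G j s m i \<le> taboo_iter G j s n i"
proof -
  have "taboo_iter G j s n i \<le> taboo_iter G j s (Suc n) i" for n i
  proof (induction n arbitrary: i)
    case 0
    show ?case using taboo_iter_nonneg[OF G s, of j 1 i] by auto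
  next
    case (Suc n)
    then show ?case
      unfolding taboo_iter.simps(2)[of G j s "Suc n"] taboo_iter.simps(2)[of G j s n]
      using s by (auto intro!: mult_left_mono opL_mono[OF G] simp del: taboo_iter.simps)
  qed
  then show ?thesis using \<open>m \<le> n\<close> by (rule lift_Suc_mono_le)
qed

locale multiplicative_eigenfunction =
  fixes G :: "('e::finite, 'a::finite, 'b::finite) game" and h :: "'e \<Rightarrow> real" and \<Lambda> :: real
  assumes G: "is_game G" and h_pos: "\<And>i. 0 < h i" and eigen: "\<And>i. \<Lambda> * h i = opL G h i"
begin

lemma eigenfunction_max: obtains i where "\<And>y. h y \<le> h i"
proof -
  have "Max (range h) \<in> range h" by (intro Max_in) auto
  then obtain i where "Max (range h) = h i" by (rule rangeE)
  then show thesis using Max_ge[of "range h"] that[of i] by simp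
qed

lemma eigenfunction_min: obtains i where "\<And>y. h i \<le> h y"
proof -
  have "Min (range h) \<in> range h" by (intro Min_in) auto
  then obtain i where "Min (range h) = h i" by (rule rangeE)
  then show thesis using Min_le[of "range h"] that[of i] by simp
qed

text \<open>
  Evaluate the eigenvalue equation where \<open>h\<close> is minimal and where it is maximal.
\<close>

lemma eigenvalue_bounds: "exp (theta G * cost_min G) \<le> \<Lambda>" "\<Lambda> \<le> exp (theta G * cost_max G)"
proof -
  obtain i where i: "\<And>y. h i \<le> h y" using eigenfunction_min by blast
  have avg: "h i \<le> (\<Sum>y\<in>UNIV. pmf p y * h y)" for p
    using i by (rule sum_pmf_weights_ge)
  have "exp (theta G * cost_min G) * h i \<le> opL G h i"
  proof (rule opL_ge[OF G])
    fix a b assume ab: "a \<in> actA G i" "b \<in> actB G i"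
    have "exp (theta G * cost_min G) * h i \<le>
        exp (theta G * cost_min G) * (\<Sum>y\<in>UNIV. pmf (trans_law G i a b) y * h y)"
      using avg by (intro mult_left_mono) auto
    also have "\<dots> \<le> one_step G h i a b"
      using avg[of "trans_law G i a b"] h_pos[of i] by (intro one_step_lower[OF G ab]) linarith
    finally show "exp (theta G * cost_min G) * h i \<le> one_step G h i a b" .
  qed
  then show "exp (theta G * cost_min G) \<le> \<Lambda>"
    using h_pos[of i] by (simp flip: eigen)
next
  obtain i where i: "\<And>y. h y \<le> h i" using eigenfunction_max by blast
  have avg: "(\<Sum>y\<in>UNIV. pmf p y * h y) \<le> h i" for p
    using i by (rule sum_pmf_weights_le)
  have "opL G h i \<le> exp (theta G * cost_max G) * h i"
  proof (rule opL_le[OF G])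
    fix a b assume ab: "a \<in> actA G i" "b \<in> actB G i"
    have "one_step G h i a b \<le>
        exp (theta G * cost_max G) * (\<Sum>y\<in>UNIV. pmf (trans_law G i a b) y * h y)"
      using h_pos by (intro one_step_upper[OF G ab]) (auto intro!: sum_nonneg simp: less_imp_le)
    also have "\<dots> \<le> exp (theta G * cost_max G) * h i"
      using avg by (intro mult_left_mono) auto
    finally show "one_step G h i a b \<le> exp (theta G * cost_max G) * h i" .
  qed
  then show "\<Lambda> \<le> exp (theta G * cost_max G)"
    using h_pos[of i] by (simp flip: eigen)
qed

lemma eigenvalue_pos: "0 < \<Lambda>"
  using eigenvalue_bounds(1) by (rule less_le_trans[rotated]) simp

text \<open>
  Since the value lies between the extreme costs, one step multiplies the normalized exponential
  cost by at most this factor and at least its inverse.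
\<close>

definition cost_ratio :: real where "cost_ratio = exp (theta G * cost_span G)"

lemma cost_ratio_eq: "cost_ratio = exp (theta G * cost_max G) / exp (theta G * cost_min G)"
  by (simp add: cost_ratio_def cost_span_def cost_max_def cost_min_def right_diff_distrib flip: exp_diff)

lemma cost_ratio_ge_1: "1 \<le> cost_ratio"
  using order.trans[OF eigenvalue_bounds] by (simp add: cost_ratio_eq)

lemma exp_cost_max_le: "exp (theta G * cost_max G) \<le> \<Lambda> * cost_ratio"
  using mult_right_mono[OF eigenvalue_bounds(1), of "exp (theta G * cost_max G)"]
  by (simp add: cost_ratio_eq field_simps)

lemma exp_cost_min_ge: "\<Lambda> / cost_ratio \<le> exp (theta G * cost_min G)"
  using eigenvalue_bounds(2) by (simp add: cost_ratio_eq field_simps)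

lemma one_step_le_avg:
  assumes ab: "a \<in> actA G i" "b \<in> actB G i"
    and g: "0 \<le> (\<Sum>y\<in>UNIV. pmf (trans_law G i a b) y * g y)"
  shows "one_step G g i a b \<le> \<Lambda> * cost_ratio * (\<Sum>y\<in>UNIV. pmf (trans_law G i a b) y * g y)"
  using one_step_upper[OF G ab g] mult_right_mono[OF exp_cost_max_le g] by linarith

lemma one_step_ge_avg:
  assumes ab: "a \<in> actA G i" "b \<in> actB G i"
    and g: "0 \<le> (\<Sum>y\<in>UNIV. pmf (trans_law G i a b) y * g y)"
  shows "\<Lambda> / cost_ratio * (\<Sum>y\<in>UNIV. pmf (trans_law G i a b) y * g y) \<le> one_step G g i a b"
  using one_step_lower[OF G ab g] mult_right_mono[OF exp_cost_min_ge g] by linarith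

lemma taboo_iter_le_eigenfunction:
  assumes hj: "h j = 1" and s: "0 \<le> s" "s \<le> 1 / \<Lambda>"
  shows "taboo_iter G j s n i \<le> h i"
proof (induction n arbitrary: i)
  case 0
  then show ?case using hj h_pos[of i] by auto
next
  case (Suc n)
  have "s * opL G (taboo_iter G j s n) i \<le> s * (\<Lambda> * h i)"
    unfolding eigen using s Suc by (intro mult_left_mono opL_mono[OF G]) auto
  also have "\<dots> \<le> 1 / \<Lambda> * (\<Lambda> * h i)"
    using s eigenvalue_pos h_pos[of i] by (intro mult_right_mono) auto
  also have "\<dots> = h i" using eigenvalue_pos by simp
  finally show ?case using hj by simp
qed

text \<open>
  Each step of the iteration uses the factor \<open>s\<close> at most once, so passing from \<open>1/\<Lambda>\<close> to a smaller
  factor loses at most a power of the quotient.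
\<close>

lemma taboo_iter_discount:
  assumes r: "0 \<le> r" "r \<le> 1" and s: "r / \<Lambda> \<le> s"
  shows "r ^ n * taboo_iter G j (1 / \<Lambda>) n i \<le> taboo_iter G j s n i"
proof (induction n arbitrary: i)
  case (Suc n)
  have s0: "0 \<le> s" using s r eigenvalue_pos by (meson divide_nonneg_pos order.trans)
  have "r ^ Suc n * (1 / \<Lambda> * opL G (taboo_iter G j (1 / \<Lambda>) n) i)
      = r / \<Lambda> * opL G (\<lambda>y. r ^ n * taboo_iter G j (1 / \<Lambda>) n y) i"
    using r by (simp add: opL_scale[OF G])
  also have "\<dots> \<le> s * opL G (taboo_iter G j s n) i"
    using s s0 r eigenvalue_pos Suc
    by (intro mult_mono opL_mono[OF G] opL_nonneg[OF G] mult_nonneg_nonneg taboo_iter_nonneg[OF G]) auto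
  finally show ?case using r by (auto simp: power_le_one mult_le_one simp del: power_Suc)
qed simp

lemma taboo_iter_upper: "taboo_iter G j (1 / \<Lambda>) n i \<le> cost_ratio ^ n"
proof (induction n arbitrary: i)
  case (Suc n)
  have 1: "1 \<le> cost_ratio ^ Suc n" using cost_ratio_ge_1 by (rule one_le_power)
  have nn: "0 \<le> taboo_iter G j (1 / \<Lambda>) n y" for y
    using eigenvalue_pos by (intro taboo_iter_nonneg[OF G]) auto
  have "opL G (taboo_iter G j (1 / \<Lambda>) n) i \<le> \<Lambda> * cost_ratio * cost_ratio ^ n"
  proof (rule opL_le[OF G])
    fix a b assume ab: "a \<in> actA G i" "b \<in> actB G i"
    have "one_step G (taboo_iter G j (1 / \<Lambda>) n) i a b \<le>
       \<Lambda> * cost_ratio * (\<Sum>y\<in>UNIV. pmf (trans_law G i a b) y * taboo_iter G j (1 / \<Lambda>) n y)"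
      by (intro one_step_le_avg ab sum_nonneg mult_nonneg_nonneg nn) auto
    also have "\<dots> \<le> \<Lambda> * cost_ratio * cost_ratio ^ n"
      using eigenvalue_pos cost_ratio_ge_1 Suc by (intro mult_left_mono sum_pmf_weights_le) auto
    finally show "one_step G (taboo_iter G j (1 / \<Lambda>) n) i a b \<le> \<Lambda> * cost_ratio * cost_ratio ^ n" .
  qed
  then show ?case using 1 eigenvalue_pos by (auto simp: field_simps)
qed simp

text \<open>
  In the first \<open>n\<close> steps the players cannot prevent a visit to \<open>j\<close> with more than the maximal
  avoidance probability, and until then the cost shrinks by at most the cost ratio per step.
\<close>

lemma taboo_iter_lower: "(1 - max_avoid G j n i) / cost_ratio ^ n \<le> taboo_iter G j (1 / \<Lambda>) n i"
proof (induction n arbitrary: i)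
  case (Suc n)
  show ?case
  proof (cases "i = j")
    case True
    then show ?thesis using one_le_power[OF cost_ratio_ge_1, of "Suc n"] by simp
  next
    case False
    have nn: "0 \<le> taboo_iter G j (1 / \<Lambda>) n y" for y
      using eigenvalue_pos by (intro taboo_iter_nonneg[OF G]) auto
    have "\<Lambda> / cost_ratio * ((1 - max_avoid G j (Suc n) i) / cost_ratio ^ n) \<le> opL G (taboo_iter G j (1 / \<Lambda>) n) i"
    proof (rule opL_ge[OF G])
      fix a b assume ab: "a \<in> actA G i" "b \<in> actB G i"
      have "(1 - max_avoid G j (Suc n) i) / cost_ratio ^ n
          \<le> (1 - (\<Sum>y\<in>UNIV. pmf (trans_law G i a b) y * max_avoid G j n y)) / cost_ratio ^ n"
        using max_avoid_ge[OF False ab, of n] cost_ratio_ge_1 by (intro divide_right_mono) auto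
      also have "\<dots> = (\<Sum>y\<in>UNIV. pmf (trans_law G i a b) y * ((1 - max_avoid G j n y) / cost_ratio ^ n))"
        by (simp add: right_diff_distrib sum_subtractf sum_pmf_eq_1 flip: sum_divide_distrib)
      also have "\<dots> \<le> (\<Sum>y\<in>UNIV. pmf (trans_law G i a b) y * taboo_iter G j (1 / \<Lambda>) n y)"
        using Suc by (intro sum_mono mult_left_mono) auto
      finally have "\<Lambda> / cost_ratio * ((1 - max_avoid G j (Suc n) i) / cost_ratio ^ n) \<le>
         \<Lambda> / cost_ratio * (\<Sum>y\<in>UNIV. pmf (trans_law G i a b) y * taboo_iter G j (1 / \<Lambda>) n y)"
        using eigenvalue_pos cost_ratio_ge_1 by (intro mult_left_mono) auto
      also have "\<dots> \<le> one_step G (taboo_iter G j (1 / \<Lambda>) n) i a b"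
        by (intro one_step_ge_avg ab sum_nonneg mult_nonneg_nonneg nn) auto
      finally show "\<Lambda> / cost_ratio * ((1 - max_avoid G j (Suc n) i) / cost_ratio ^ n) \<le> one_step G (taboo_iter G j (1 / \<Lambda>) n) i a b" .
    qed
    then have "1 / \<Lambda> * (\<Lambda> / cost_ratio * ((1 - max_avoid G j (Suc n) i) / cost_ratio ^ n)) \<le> 1 / \<Lambda> * opL G (taboo_iter G j (1 / \<Lambda>) n) i"
      using eigenvalue_pos by (intro mult_left_mono) auto
    moreover have "1 / \<Lambda> * (\<Lambda> / cost_ratio * ((1 - max_avoid G j (Suc n) i) / cost_ratio ^ n)) = (1 - max_avoid G j (Suc n) i) / cost_ratio ^ Suc n"
      using eigenvalue_pos by simp
    ultimately show ?thesis using False by (simp only: taboo_iter.simps if_False)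
  qed
qed simp

text \<open>
  Both \<open>h\<close> and the iterates take the value 1 at \<open>j\<close>, so only paths avoiding \<open>j\<close> carry the gap
  forward. The difference of the two min-max values is bounded by letting both players maximize, which is
  the recursion of \<^const>\<open>max_avoid\<close> up to the cost ratio.
\<close>

lemma eigenfunction_gap:
  assumes hj: "h j = 1" and C: "\<And>i. h i - taboo_iter G j (1 / \<Lambda>) k i \<le> C"
  shows "h i - taboo_iter G j (1 / \<Lambda>) (k + n) i \<le> C * cost_ratio ^ n * max_avoid G j n i"
proof (induction n arbitrary: i)
  case 0
  then show ?case using hj C[of i] by auto
next
  case (Suc n)
  let ?V = "taboo_iter G j (1 / \<Lambda>)"
  have "0 \<le> C" using C[of j] hj by simp
  have nn: "0 \<le> h y - ?V (k + n) y" for y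
    using taboo_iter_le_eigenfunction[OF hj, of "1 / \<Lambda>"] eigenvalue_pos by simp
  show ?case
  proof (cases "i = j")
    case True
    then show ?thesis using hj by simp
  next
    case False
    have "opL G h i - opL G (?V (k + n)) i \<le> \<Lambda> * cost_ratio * (C * cost_ratio ^ n * max_avoid G j (Suc n) i)"
    proof (rule opL_diff_le[OF G])
      fix a b assume ab: "a \<in> actA G i" "b \<in> actB G i"
      let ?p = "pmf (trans_law G i a b)"
      have "one_step G (\<lambda>y. h y - ?V (k + n) y) i a b \<le> \<Lambda> * cost_ratio * (\<Sum>y\<in>UNIV. ?p y * (h y - ?V (k + n) y))"
        by (intro one_step_le_avg ab sum_nonneg mult_nonneg_nonneg nn) auto
      also have "\<dots> \<le> \<Lambda> * cost_ratio * (\<Sum>y\<in>UNIV. ?p y * (C * cost_ratio ^ n * max_avoid G j n y))"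
        using eigenvalue_pos cost_ratio_ge_1 Suc by (intro mult_left_mono sum_mono) auto
      also have "\<dots> = \<Lambda> * cost_ratio * (C * cost_ratio ^ n * (\<Sum>y\<in>UNIV. ?p y * max_avoid G j n y))"
        by (simp add: sum_distrib_left mult_ac)
      also have "\<dots> \<le> \<Lambda> * cost_ratio * (C * cost_ratio ^ n * max_avoid G j (Suc n) i)"
        using eigenvalue_pos cost_ratio_ge_1 \<open>0 \<le> C\<close> max_avoid_ge[OF False ab]
        by (intro mult_left_mono) auto
      finally show "one_step G (\<lambda>y. h y - ?V (k + n) y) i a b \<le> \<Lambda> * cost_ratio * (C * cost_ratio ^ n * max_avoid G j (Suc n) i)" .
    qed
    then have "1 / \<Lambda> * (\<Lambda> * h i - opL G (?V (k + n)) i) \<le> 1 / \<Lambda> * (\<Lambda> * cost_ratio * (C * cost_ratio ^ n * max_avoid G j (Suc n) i))"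
      unfolding eigen using eigenvalue_pos by (intro mult_left_mono) auto
    moreover have "1 / \<Lambda> * (\<Lambda> * cost_ratio * (C * cost_ratio ^ n * max_avoid G j (Suc n) i)) = C * cost_ratio ^ Suc n * max_avoid G j (Suc n) i"
      using eigenvalue_pos by simp
    moreover have "1 / \<Lambda> * (\<Lambda> * h i - opL G (?V (k + n)) i) = h i - ?V (k + Suc n) i"
      using eigenvalue_pos False by (simp add: right_diff_distrib)
    ultimately show ?thesis by simp
  qed
qed

end

section \<open>Growth rate of the exponential cost\<close>

lemma opLw_UNIV:
  assumes "set_pmf \<mu> \<subseteq> actA G i" "set_pmf \<nu> \<subseteq> actB G i"
  shows "opLw G (pmf \<mu>) (pmf \<nu>) h i = (\<Sum>a\<in>UNIV. \<Sum>b\<in>UNIV. pmf \<mu> a * pmf \<nu> b * one_step G h i a b)"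
proof -
  have A: "pmf \<mu> a = 0" if "a \<notin> actA G i" for a using that assms by (auto simp: pmf_eq_0_set_pmf)
  have B: "pmf \<nu> b = 0" if "b \<notin> actB G i" for b using that assms by (auto simp: pmf_eq_0_set_pmf)
  have "opLw G (pmf \<mu>) (pmf \<nu>) h i = (\<Sum>a\<in>actA G i. \<Sum>b\<in>UNIV. pmf \<mu> a * pmf \<nu> b * one_step G h i a b)"
    unfolding opLw_one_step by (intro sum.cong sum.mono_neutral_cong_left) (auto simp: B)
  also have "\<dots> = (\<Sum>a\<in>UNIV. \<Sum>b\<in>UNIV. pmf \<mu> a * pmf \<nu> b * one_step G h i a b)"
    by (intro sum.mono_neutral_left) (auto simp: A)
  finally show ?thesis .
qed

definition cost_factor :: "('e::finite, 'a::finite, 'b::finite) game \<Rightarrow> 'e \<times> 'a \<times> 'b \<Rightarrow> real" where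
  "cost_factor G = (\<lambda>(x, a, b). exp (theta G * cost G x a b))"

lemma set_pmf_policies:
  assumes "set hs \<subseteq> admissible G"
  shows "\<pi> \<in> policies1 G \<Longrightarrow> set_pmf (\<pi> hs x) \<subseteq> actA G x"
    and "\<sigma> \<in> policies2 G \<Longrightarrow> set_pmf (\<sigma> hs x) \<subseteq> actB G x"
  using assms by (auto simp: policies1_def policies2_def)

lemma shift_policies:
  assumes "(x, a, b) \<in> admissible G"
  shows "\<pi> \<in> policies1 G \<Longrightarrow> shift_policy (x, a, b) \<pi> \<in> policies1 G"
    and "\<sigma> \<in> policies2 G \<Longrightarrow> shift_policy (x, a, b) \<sigma> \<in> policies2 G"
  using assms by (auto simp: policies1_def policies2_def shift_policy_def)

lemma sum_avg_eq_opLw: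
  fixes G :: "('e::finite, 'a::finite, 'b::finite) game"
  assumes "\<pi> \<in> policies1 G" "\<sigma> \<in> policies2 G"
  shows "(\<Sum>a\<in>UNIV. \<Sum>b\<in>UNIV. pmf (\<pi> [] x) a * pmf (\<sigma> [] x) b * cost_factor G (x, a, b) *
      (c * (\<Sum>y\<in>UNIV. pmf (trans_law G x a b) y * h y))) = c * opLw G (pmf (\<pi> [] x)) (pmf (\<sigma> [] x)) h x"
proof -
  have "set_pmf (\<pi> [] x) \<subseteq> actA G x" "set_pmf (\<sigma> [] x) \<subseteq> actB G x"
    using assms by (auto simp: policies1_def policies2_def)
  then show ?thesis
    by (simp add: opLw_UNIV cost_factor_def one_step_def sum_distrib_left mult_ac)
qed

text \<open>
  Triples that are not admissible have weight zero, so the comparison is needed on admissible ones only.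
\<close>

lemma expect_prod_Suc_mono:
  assumes pol: "\<pi> \<in> policies1 G" "\<sigma> \<in> policies2 G"
    and le: "\<And>x a b. (x, a, b) \<in> admissible G \<Longrightarrow> F x a b \<le> F' x a b"
  shows "(\<Sum>x\<in>UNIV. \<Sum>a\<in>UNIV. \<Sum>b\<in>UNIV. pmf p x * pmf (\<pi> [] x) a * pmf (\<sigma> [] x) b * cost_factor G (x, a, b) * F x a b)
    \<le> (\<Sum>x\<in>UNIV. pmf p x * (\<Sum>a\<in>UNIV. \<Sum>b\<in>UNIV. pmf (\<pi> [] x) a * pmf (\<sigma> [] x) b * cost_factor G (x, a, b) * F' x a b))"
    (is "?L \<le> _")
proof -
  have key: "pmf (\<pi> [] x) a * pmf (\<sigma> [] x) b * cost_factor G (x, a, b) * F x a b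
     \<le> pmf (\<pi> [] x) a * pmf (\<sigma> [] x) b * cost_factor G (x, a, b) * F' x a b" for x a b
  proof (cases "(x, a, b) \<in> admissible G")
    case True
    then show ?thesis using le[OF True] by (intro mult_left_mono) (auto simp: cost_factor_def)
  next
    case False
    then have "pmf (\<pi> [] x) a = 0 \<or> pmf (\<sigma> [] x) b = 0"
      using set_pmf_policies(1)[of "[]" G \<pi> x] set_pmf_policies(2)[of "[]" G \<sigma> x] pol
      by (auto simp: admissible_def pmf_eq_0_set_pmf)
    then show ?thesis by auto
  qed
  have "(\<Sum>x\<in>UNIV. pmf p x * (\<Sum>a\<in>UNIV. \<Sum>b\<in>UNIV. pmf (\<pi> [] x) a * pmf (\<sigma> [] x) b * cost_factor G (x, a, b) * F x a b))
    \<le> (\<Sum>x\<in>UNIV. pmf p x * (\<Sum>a\<in>UNIV. \<Sum>b\<in>UNIV. pmf (\<pi> [] x) a * pmf (\<sigma> [] x) b * cost_factor G (x, a, b) * F' x a b))"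
    by (rule sum_mono, rule mult_left_mono, rule sum_mono, rule sum_mono, rule key) simp
  moreover have "?L = (\<Sum>x\<in>UNIV. pmf p x * (\<Sum>a\<in>UNIV. \<Sum>b\<in>UNIV. pmf (\<pi> [] x) a * pmf (\<sigma> [] x) b * cost_factor G (x, a, b) * F x a b))"
    by (simp add: sum_distrib_left mult_ac)
  ultimately show ?thesis by simp
qed

text \<open>
  A one-step inequality between \<open>h\<close> and a multiple of \<open>h\<close>, valid after every admissible history, propagates along the
  process. The policies are shifted in the induction step, hence the hypothesis about all such histories.
\<close>

lemma expect_prod_upper:
  assumes m: "0 < m" "\<And>x. m \<le> h x" and L: "0 \<le> L"
    and pol: "\<pi> \<in> policies1 G" "\<sigma> \<in> policies2 G"
    and le: "\<And>hs x. set hs \<subseteq> admissible G \<Longrightarrow> opLw G (pmf (\<pi> hs x)) (pmf (\<sigma> hs x)) h x \<le> L * h x"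
  shows "expect_prod G (cost_factor G) n p \<pi> \<sigma> \<le> L ^ n / m * (\<Sum>x\<in>UNIV. pmf p x * h x)"
  using pol le
proof (induction n arbitrary: p \<pi> \<sigma>)
  case 0
  have "m \<le> (\<Sum>x\<in>UNIV. pmf p x * h x)" using m by (intro sum_pmf_weights_ge)
  then show ?case using m by simp
next
  case (Suc n)
  have "expect_prod G (cost_factor G) (Suc n) p \<pi> \<sigma> \<le> (\<Sum>x\<in>UNIV. pmf p x * (\<Sum>a\<in>UNIV. \<Sum>b\<in>UNIV.
      pmf (\<pi> [] x) a * pmf (\<sigma> [] x) b * cost_factor G (x, a, b) * (L ^ n / m * (\<Sum>y\<in>UNIV. pmf (trans_law G x a b) y * h y))))"
    unfolding expect_prod.simps
  proof (rule expect_prod_Suc_mono[OF Suc.prems(1,2)])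
    fix x a b assume t: "(x, a, b) \<in> admissible G"
    show "expect_prod G (cost_factor G) n (trans_law G x a b) (shift_policy (x, a, b) \<pi>) (shift_policy (x, a, b) \<sigma>)
      \<le> L ^ n / m * (\<Sum>y\<in>UNIV. pmf (trans_law G x a b) y * h y)"
    proof (rule Suc.IH[OF shift_policies(1)[OF t Suc.prems(1)] shift_policies(2)[OF t Suc.prems(2)]])
      fix hs y assume "set hs \<subseteq> admissible G"
      then show "opLw G (pmf (shift_policy (x, a, b) \<pi> hs y)) (pmf (shift_policy (x, a, b) \<sigma> hs y)) h y \<le> L * h y"
        unfolding shift_policy_def using t by (intro Suc.prems(3)) auto
    qed
  qed
  also have "\<dots> \<le> (\<Sum>x\<in>UNIV. pmf p x * (L ^ n / m * (L * h x)))"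
    unfolding sum_avg_eq_opLw[OF Suc.prems(1,2)] using m L Suc.prems(3)[of "[]"]
    by (intro sum_mono mult_left_mono) auto
  also have "\<dots> = L ^ Suc n / m * (\<Sum>x\<in>UNIV. pmf p x * h x)"
    by (simp add: sum_distrib_left mult_ac)
  finally show ?case .
qed

lemma expect_prod_lower:
  assumes m: "0 < m" "\<And>x. 0 \<le> h x" "\<And>x. h x \<le> m" and L: "0 \<le> L"
    and pol: "\<pi> \<in> policies1 G" "\<sigma> \<in> policies2 G"
    and ge: "\<And>hs x. set hs \<subseteq> admissible G \<Longrightarrow> L * h x \<le> opLw G (pmf (\<pi> hs x)) (pmf (\<sigma> hs x)) h x"
  shows "L ^ n / m * (\<Sum>x\<in>UNIV. pmf p x * h x) \<le> expect_prod G (cost_factor G) n p \<pi> \<sigma>"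
  using pol ge
proof (induction n arbitrary: p \<pi> \<sigma>)
  case 0
  have "(\<Sum>x\<in>UNIV. pmf p x * h x) \<le> m" using m by (intro sum_pmf_weights_le)
  then show ?case using m by simp
next
  case (Suc n)
  have "L ^ Suc n / m * (\<Sum>x\<in>UNIV. pmf p x * h x) = (\<Sum>x\<in>UNIV. pmf p x * (L ^ n / m * (L * h x)))"
    by (simp add: sum_distrib_left mult_ac)
  also have "\<dots> \<le> (\<Sum>x\<in>UNIV. pmf p x * (L ^ n / m * opLw G (pmf (\<pi> [] x)) (pmf (\<sigma> [] x)) h x))"
    using m L Suc.prems(3)[of "[]"] by (intro sum_mono mult_left_mono) auto
  \<comment> \<open>Negation turns the monotonicity lemma around.\<close>
  also have "\<dots> = - (\<Sum>x\<in>UNIV. pmf p x * (\<Sum>a\<in>UNIV. \<Sum>b\<in>UNIV.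
      pmf (\<pi> [] x) a * pmf (\<sigma> [] x) b * cost_factor G (x, a, b) * - (L ^ n / m * (\<Sum>y\<in>UNIV. pmf (trans_law G x a b) y * h y))))"
    unfolding sum_avg_eq_opLw[OF Suc.prems(1,2), symmetric] by (simp add: sum_negf)
  also have "\<dots> \<le> - (\<Sum>x\<in>UNIV. \<Sum>a\<in>UNIV. \<Sum>b\<in>UNIV. pmf p x * pmf (\<pi> [] x) a * pmf (\<sigma> [] x) b * cost_factor G (x, a, b) *
      - expect_prod G (cost_factor G) n (trans_law G x a b) (shift_policy (x, a, b) \<pi>) (shift_policy (x, a, b) \<sigma>))"
    unfolding neg_le_iff_le
  proof (rule expect_prod_Suc_mono[OF Suc.prems(1,2)], unfold neg_le_iff_le)
    fix x a b assume t: "(x, a, b) \<in> admissible G"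
    show "L ^ n / m * (\<Sum>y\<in>UNIV. pmf (trans_law G x a b) y * h y) \<le>
      expect_prod G (cost_factor G) n (trans_law G x a b) (shift_policy (x, a, b) \<pi>) (shift_policy (x, a, b) \<sigma>)"
    proof (rule Suc.IH[OF shift_policies(1)[OF t Suc.prems(1)] shift_policies(2)[OF t Suc.prems(2)]])
      fix hs y assume "set hs \<subseteq> admissible G"
      then show "L * h y \<le> opLw G (pmf (shift_policy (x, a, b) \<pi> hs y)) (pmf (shift_policy (x, a, b) \<sigma> hs y)) h y"
        unfolding shift_policy_def using t by (intro Suc.prems(3)) auto
    qed
  qed
  also have "\<dots> = expect_prod G (cost_factor G) (Suc n) p \<pi> \<sigma>"
    by (simp add: sum_negf)
  finally show ?case .
qed

lemma avg_cost_eq_limsup: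
  "avg_cost G i \<pi> \<sigma> = limsup (\<lambda>n. ereal (1 / (theta G * real n) * ln (expect_prod G (cost_factor G) n (return_pmf i) \<pi> \<sigma>)))"
proof -
  have "exp (theta G * (\<Sum>k<n. case \<omega> k of (x, a, b) \<Rightarrow> cost G x a b)) = (\<Prod>k<n. cost_factor G (\<omega> k))" for n :: nat and \<omega>
    unfolding sum_distrib_left by (subst exp_sum) (auto simp: cost_factor_def case_prod_unfold)
  then show ?thesis unfolding avg_cost_def by (simp add: integral_prod_expect_prod)
qed

lemma expect_prod_ge_1:
  assumes G: "is_game G" and pol: "\<pi> \<in> policies1 G" "\<sigma> \<in> policies2 G"
  shows "1 \<le> expect_prod G (cost_factor G) n p \<pi> \<sigma>"
proof -
  have "1 \<le> opLw G (pmf (\<pi> hs x)) (pmf (\<sigma> hs x)) (\<lambda>_. 1) x" if "set hs \<subseteq> admissible G" for hs x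
  proof (rule opLw_ge)
    show "set_pmf (\<pi> hs x) \<subseteq> actA G x" "set_pmf (\<sigma> hs x) \<subseteq> actB G x"
      using pol that by (auto simp: policies1_def policies2_def)
    fix a b assume "a \<in> actA G x" "b \<in> actB G x"
    then show "1 \<le> one_step G (\<lambda>_. 1) x a b"
      using G by (auto simp: one_step_def is_game_def admissible_def sum_pmf_eq_1)
  qed
  then show ?thesis
    using expect_prod_lower[of 1 "\<lambda>_. 1" 1 \<pi> G \<sigma> n p] pol by (simp add: sum_pmf_eq_1)
qed

lemma tendsto_log_growth:
  fixes \<theta> C L :: real
  assumes "0 < \<theta>" "0 < C" "0 < L"
  shows "(\<lambda>n. ereal (1 / (\<theta> * real n) * ln (C * L ^ n))) \<longlonglongrightarrow> ereal (ln L / \<theta>)"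
proof -
  have "(\<lambda>n. ln C / \<theta> * (1 / real n) + ln L / \<theta>) \<longlonglongrightarrow> ln C / \<theta> * 0 + ln L / \<theta>"
    by (intro tendsto_intros lim_1_over_n)
  moreover have "eventually (\<lambda>n. ln C / \<theta> * (1 / real n) + ln L / \<theta> = 1 / (\<theta> * real n) * ln (C * L ^ n)) sequentially"
    using eventually_gt_at_top[of 0]
    by eventually_elim (use assms in \<open>simp add: ln_mult ln_realpow field_simps\<close>)
  ultimately show ?thesis by (auto dest: Lim_transform_eventually)
qed

text \<open>
  The expected exponential cost is at most a constant times \<open>L ^ n\<close>, and constants disappear in the growth rate.
\<close>

lemma avg_cost_upper:
  fixes G :: "('e::finite, 'a::finite, 'b::finite) game" and h :: "'e \<Rightarrow> real"
  assumes G: "is_game G" and h: "\<And>x. 0 < h x" and L: "0 < L"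
    and pol: "\<pi> \<in> policies1 G" "\<sigma> \<in> policies2 G"
    and le: "\<And>hs x. set hs \<subseteq> admissible G \<Longrightarrow> opLw G (pmf (\<pi> hs x)) (pmf (\<sigma> hs x)) h x \<le> L * h x"
  shows "avg_cost G i \<pi> \<sigma> \<le> ereal (ln L / theta G)"
proof -
  let ?m = "Min (range h)"
  have th: "0 < theta G" using G by (simp add: is_game_def)
  have m: "0 < ?m" "?m \<le> h x" for x using h by auto
  define C where "C = (\<Sum>x\<in>UNIV. pmf (return_pmf i) x * h x) / ?m"
  have E: "expect_prod G (cost_factor G) n (return_pmf i) \<pi> \<sigma> \<le> C * L ^ n" for n
    using expect_prod_upper[OF m less_imp_le[OF L] pol le, of n "return_pmf i"] by (simp add: C_def mult_ac)
  have E1: "1 \<le> expect_prod G (cost_factor G) n (return_pmf i) \<pi> \<sigma>" for n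
    by (rule expect_prod_ge_1[OF G pol])
  have "0 < C" using E[of 0] by simp
  have "avg_cost G i \<pi> \<sigma> \<le> limsup (\<lambda>n. ereal (1 / (theta G * real n) * ln (C * L ^ n)))"
    unfolding avg_cost_eq_limsup
  proof (intro Limsup_mono always_eventually allI)
    fix n
    have "ln (expect_prod G (cost_factor G) n (return_pmf i) \<pi> \<sigma>) \<le> ln (C * L ^ n)"
      using E[of n] E1[of n] by simp
    then show "ereal (1 / (theta G * real n) * ln (expect_prod G (cost_factor G) n (return_pmf i) \<pi> \<sigma>))
        \<le> ereal (1 / (theta G * real n) * ln (C * L ^ n))"
      using th by (simp add: divide_right_mono)
  qed
  also have "\<dots> = ereal (ln L / theta G)"
    using tendsto_log_growth[OF th \<open>0 < C\<close> L] by (intro lim_imp_Limsup) auto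
  finally show ?thesis .
qed

lemma avg_cost_lower:
  fixes G :: "('e::finite, 'a::finite, 'b::finite) game" and h :: "'e \<Rightarrow> real"
  assumes G: "is_game G" and h: "\<And>x. 0 < h x" and L: "0 < L"
    and pol: "\<pi> \<in> policies1 G" "\<sigma> \<in> policies2 G"
    and ge: "\<And>hs x. set hs \<subseteq> admissible G \<Longrightarrow> L * h x \<le> opLw G (pmf (\<pi> hs x)) (pmf (\<sigma> hs x)) h x"
  shows "ereal (ln L / theta G) \<le> avg_cost G i \<pi> \<sigma>"
proof -
  let ?m = "Max (range h)"
  have th: "0 < theta G" using G by (simp add: is_game_def)
  have m: "h x \<le> ?m" for x by simp
  have m0: "0 < ?m" using m[of i] h[of i] by linarith
  define C where "C = (\<Sum>x\<in>UNIV. pmf (return_pmf i) x * h x) / ?m"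
  have E: "C * L ^ n \<le> expect_prod G (cost_factor G) n (return_pmf i) \<pi> \<sigma>" for n
    using expect_prod_lower[OF m0 less_imp_le[OF h] m less_imp_le[OF L] pol ge, of n "return_pmf i"]
    by (simp add: C_def mult_ac)
  have "Min (range h) \<le> (\<Sum>x\<in>UNIV. pmf (return_pmf i) x * h x)"
    by (intro sum_pmf_weights_ge) auto
  moreover have "0 < Min (range h)" using h by auto
  ultimately have "0 < C" using m0 by (simp add: C_def)
  have "ereal (ln L / theta G) = limsup (\<lambda>n. ereal (1 / (theta G * real n) * ln (C * L ^ n)))"
    using tendsto_log_growth[OF th \<open>0 < C\<close> L] by (intro lim_imp_Limsup[symmetric]) auto
  also have "\<dots> \<le> avg_cost G i \<pi> \<sigma>"
    unfolding avg_cost_eq_limsup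
  proof (intro Limsup_mono always_eventually allI)
    fix n
    have "0 < C * L ^ n" using \<open>0 < C\<close> L by simp
    then have "ln (C * L ^ n) \<le> ln (expect_prod G (cost_factor G) n (return_pmf i) \<pi> \<sigma>)"
      using E[of n] by simp
    then show "ereal (1 / (theta G * real n) * ln (C * L ^ n))
        \<le> ereal (1 / (theta G * real n) * ln (expect_prod G (cost_factor G) n (return_pmf i) \<pi> \<sigma>))"
      using th by (simp add: divide_right_mono)
  qed
  finally show ?thesis .
qed

section \<open>Two-sided approximation of the eigenvalue\<close>

context multiplicative_eigenfunction
begin

lemma eigenfunction_iterate: "(opL G ^^ n) (\<lambda>i. c * h i) = (\<lambda>i. c * \<Lambda> ^ n * h i)" if "0 \<le> c"
proof (induction n)
  case (Suc n)
  have "opL G (\<lambda>i. c * \<Lambda> ^ n * h i) = (\<lambda>i. c * \<Lambda> ^ Suc n * h i)"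
    using that eigenvalue_pos by (simp add: fun_eq_iff opL_scale[OF G] flip: eigen)
  then show ?case using Suc by simp
qed simp

lemma opL_iterate_mono:
  assumes "\<And>i. f i \<le> g i"
  shows "(opL G ^^ n) f i \<le> (opL G ^^ n) g i"
  using assms by (induction n arbitrary: i) (auto intro: opL_mono[OF G])

lemma iterate_one_ge:
  assumes "\<And>i. c * h i \<le> 1" "0 \<le> c"
  shows "c * \<Lambda> ^ n * h i \<le> (opL G ^^ n) (\<lambda>_. 1) i"
  using opL_iterate_mono[of "\<lambda>i. c * h i" "\<lambda>_. 1" n i] assms by (simp add: eigenfunction_iterate)

lemma iterate_one_le:
  assumes "\<And>i. 1 \<le> c * h i" "0 \<le> c"
  shows "(opL G ^^ n) (\<lambda>_. 1) i \<le> c * \<Lambda> ^ n * h i"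
  using opL_iterate_mono[of "\<lambda>_. 1" "\<lambda>i. c * h i" n i] assms by (simp add: eigenfunction_iterate)

text \<open>
  Where \<open>h\<close> is maximal, the normalized \<open>h\<close> equals 1 and is at most 1 elsewhere, so the iterate of the constant 1
  is at least the power of the eigenvalue there.
\<close>

lemma eigenvalue_le_lambda_approx: "\<Lambda> \<le> lambda_approx G n"
proof -
  obtain i where i: "\<And>y. h y \<le> h i" using eigenfunction_max by blast
  have "\<Lambda> ^ (2 ^ n) \<le> (opL G ^^ (2 ^ n)) (\<lambda>_. 1) i"
    using iterate_one_ge[of "1 / h i" "2 ^ n" i] i h_pos[of i] by simp
  also have "\<dots> \<le> (MAX i. (opL G ^^ (2 ^ n)) (\<lambda>_. 1) i)" by simp
  finally have "root (2 ^ n) (\<Lambda> ^ (2 ^ n)) \<le> lambda_approx G n"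
    unfolding lambda_approx_def by (intro real_root_le_mono) auto
  then show ?thesis using eigenvalue_pos by (simp add: real_root_power_cancel)
qed

lemma zeta_approx_le_eigenvalue: "zeta_approx G n \<le> \<Lambda>"
proof -
  obtain i where i: "\<And>y. h i \<le> h y" using eigenfunction_min by blast
  have "(MIN i. (opL G ^^ (2 ^ n)) (\<lambda>_. 1) i) \<le> (opL G ^^ (2 ^ n)) (\<lambda>_. 1) i" by simp
  also have "\<dots> \<le> \<Lambda> ^ (2 ^ n)"
    using iterate_one_le[of "1 / h i" "2 ^ n" i] i h_pos[of i] by simp
  finally have "zeta_approx G n \<le> root (2 ^ n) (\<Lambda> ^ (2 ^ n))"
    unfolding zeta_approx_def by (intro real_root_le_mono) auto
  then show ?thesis using eigenvalue_pos by (simp add: real_root_power_cancel)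
qed

lemma zeta_approx_pos: "0 < zeta_approx G n"
proof -
  obtain j where j: "\<And>y. h y \<le> h j" using eigenfunction_max by blast
  have "0 < (opL G ^^ m) (\<lambda>_. 1) i" for m i
  proof -
    have "0 < 1 / h j * \<Lambda> ^ m * h i" using h_pos eigenvalue_pos by simp
    also have "\<dots> \<le> (opL G ^^ m) (\<lambda>_. 1) i"
      using j h_pos[of j] by (intro iterate_one_ge) auto
    finally show ?thesis .
  qed
  then show ?thesis unfolding zeta_approx_def by (intro real_root_gt_zero) auto
qed

text \<open>
  The iterates of the constant 1 have a ratio of maximum to minimum that is bounded uniformly in
  the number of iterations, and roots of a constant converge to 1; so the search that defines the eigenvalue estimate stops.
\<close>

lemma approximation_terminates:
  assumes "1 < x"
  shows "\<exists>n\<ge>1. lambda_approx G n / zeta_approx G n \<le> x"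
proof -
  obtain i where i: "\<And>y. h i \<le> h y" using eigenfunction_min by blast
  obtain j where j: "\<And>y. h y \<le> h j" using eigenfunction_max by blast
  define R where "R = (h j / h i) * (h j / h i)"
  have "R > 0" using h_pos by (simp add: R_def)
  have ratio: "lambda_approx G n / zeta_approx G n \<le> root (2 ^ n) R" for n
  proof -
    let ?f = "(opL G ^^ (2 ^ n)) (\<lambda>_. 1)"
    have up: "?f y \<le> h j / h i * \<Lambda> ^ (2 ^ n)" for y
    proof -
      have "?f y \<le> 1 / h i * \<Lambda> ^ (2 ^ n) * h y"
        using i h_pos[of i] by (intro iterate_one_le) auto
      also have "\<dots> \<le> 1 / h i * \<Lambda> ^ (2 ^ n) * h j"
        using j h_pos[of i] eigenvalue_pos by (intro mult_left_mono) auto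
      finally show ?thesis by (simp add: mult_ac)
    qed
    have lo: "h i / h j * \<Lambda> ^ (2 ^ n) \<le> ?f y" for y
    proof -
      have "1 / h j * \<Lambda> ^ (2 ^ n) * h i \<le> 1 / h j * \<Lambda> ^ (2 ^ n) * h y"
        using i h_pos[of j] eigenvalue_pos by (intro mult_left_mono) auto
      also have "\<dots> \<le> ?f y"
        using j h_pos[of j] by (intro iterate_one_ge) auto
      finally show ?thesis by (simp add: mult_ac)
    qed
    have Max_bd: "Max (range ?f) \<le> h j / h i * \<Lambda> ^ (2 ^ n)" using up by auto
    have Min_bd: "h i / h j * \<Lambda> ^ (2 ^ n) \<le> Min (range ?f)" using lo by auto
    have pos: "0 < h i / h j * \<Lambda> ^ (2 ^ n)" using h_pos eigenvalue_pos by simp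
    have pos': "0 \<le> h j / h i * \<Lambda> ^ (2 ^ n)" using h_pos[of i] h_pos[of j] eigenvalue_pos by simp
    have "Max (range ?f) / Min (range ?f) \<le> (h j / h i * \<Lambda> ^ (2 ^ n)) / (h i / h j * \<Lambda> ^ (2 ^ n))"
      using Max_bd Min_bd pos pos' by (intro frac_le) simp_all
    also have "\<dots> = R" using h_pos[of i] h_pos[of j] eigenvalue_pos by (simp add: R_def field_simps)
    finally have "root (2 ^ n) (Max (range ?f) / Min (range ?f)) \<le> root (2 ^ n) R"
      by (intro real_root_le_mono) auto
    then show ?thesis by (simp add: lambda_approx_def zeta_approx_def real_root_divide)
  qed
  have "filterlim (\<lambda>n. 2 ^ n :: nat) sequentially sequentially"
    by (intro filterlim_subseq strict_monoI) simp
  from filterlim_compose[OF LIMSEQ_root_const[OF \<open>R > 0\<close>] this]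
  have "eventually (\<lambda>n. root (2 ^ n) R < x) sequentially"
    using assms by (rule order_tendstoD)
  then obtain n where "\<forall>m\<ge>n. root (2 ^ m) R < x" by (auto simp: eventually_sequentially)
  then have "root (2 ^ max 1 n) R < x" by simp
  then show ?thesis using ratio[of "max 1 n"] by (intro exI[of _ "max 1 n"]) auto
qed

lemma exp_rho_eps_bounds:
  assumes eps: "0 < \<epsilon>" and N: "0 < N_eps G \<epsilon>"
  shows "\<Lambda> \<le> exp (theta G * rho_eps G \<epsilon>)"
    and "exp (theta G * rho_eps G \<epsilon>) \<le> exp (theta G * \<epsilon> / (2 * real (N_eps G \<epsilon>))) * \<Lambda>"
proof -
  have th: "0 < theta G" using G by (simp add: is_game_def)
  let ?x = "exp (theta G * \<epsilon> / (2 * real (N_eps G \<epsilon>)))"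
  define m where "m = (LEAST n. n \<ge> 1 \<and> lambda_approx G n / zeta_approx G n \<le> ?x)"
  have "1 < ?x" using th eps N by simp
  from LeastI_ex[OF approximation_terminates[OF this, unfolded Bex_def]]
  have m: "lambda_approx G m / zeta_approx G m \<le> ?x" unfolding m_def by blast
  have pos: "0 < lambda_approx G m"
    using eigenvalue_pos eigenvalue_le_lambda_approx[of m] by linarith
  have rho: "exp (theta G * rho_eps G \<epsilon>) = lambda_approx G m"
    using th pos by (simp add: rho_eps_def m_def)
  show "\<Lambda> \<le> exp (theta G * rho_eps G \<epsilon>)" unfolding rho by (rule eigenvalue_le_lambda_approx)
  have "lambda_approx G m \<le> ?x * zeta_approx G m"
    using m zeta_approx_pos[of m] by (simp add: field_simps)
  also have "\<dots> \<le> ?x * \<Lambda>" using zeta_approx_le_eigenvalue by (intro mult_left_mono) auto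
  finally show "exp (theta G * rho_eps G \<epsilon>) \<le> ?x * \<Lambda>" unfolding rho .
qed

end

section \<open>Convergence of the taboo iteration\<close>

context multiplicative_eigenfunction
begin

text \<open>
  Every \<open>d\<close> iterations contract the gap by \<open>q\<close>. Contracting once gives an a priori bound for \<open>h\<close>:
  its maximum is at most \<open>cost_ratio ^ d + q\<close> times itself. Comparing \<open>q ^ k\<close> times this bound with the
  lower bound for the iterate turns the absolute gap into a relative one.
\<close>

lemma eigenfunction_le_taboo_iter:
  fixes \<gamma> E :: real and k :: nat
  defines "\<gamma> \<equiv> irreducibility_coeff G" and "q \<equiv> (1 - irreducibility_coeff G) * cost_ratio ^ CARD('e)"
  assumes hj: "h j = 1" and k: "1 \<le> k" and \<gamma>: "0 < \<gamma>" and q: "q < 1" and E: "1 < E"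
    and small: "q ^ k < \<gamma> * (1 - q) * (E - 1) / (cost_ratio ^ CARD('e)) ^ 2"
  shows "h i \<le> E * taboo_iter G j (1 / \<Lambda>) (k * CARD('e)) i"
proof -
  let ?V = "taboo_iter G j (1 / \<Lambda>)" and ?d = "CARD('e)" and ?Kd = "cost_ratio ^ CARD('e)"
  have s: "0 \<le> 1 / \<Lambda>" using eigenvalue_pos by simp
  have Kd: "1 \<le> ?Kd" using cost_ratio_ge_1 by (rule one_le_power)
  have \<gamma>1: "\<gamma> \<le> 1" unfolding \<gamma>_def by (rule irreducibility_coeff_le_1[OF G])
  have q0: "0 \<le> q" unfolding q_def using \<gamma>1 Kd by (simp add: \<gamma>_def)
  have contract: "h i - ?V (n + ?d) i \<le> q * C" if C: "\<And>i. h i - ?V n i \<le> C" for n C i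
  proof -
    have "0 \<le> C" using C[of j] hj by simp
    have "h i - ?V (n + ?d) i \<le> C * ?Kd * max_avoid G j ?d i"
      by (rule eigenfunction_gap[OF hj C])
    also have "\<dots> \<le> C * ?Kd * (1 - \<gamma>)"
      unfolding \<gamma>_def using \<open>0 \<le> C\<close> Kd by (intro mult_left_mono max_avoid_le[OF G]) auto
    finally show ?thesis by (simp add: q_def \<gamma>_def mult_ac)
  qed
  obtain i0 where i0: "\<And>y. h y \<le> h i0" using eigenfunction_max by blast
  define M where "M = h i0"
  have hM: "h y \<le> M" for y using i0 by (simp add: M_def)
  have base: "h y - ?V 0 y \<le> M" for y
    using hM[of y] taboo_iter_nonneg[OF G s, of j 0 y] by linarith
  \<comment> \<open>The a priori bound for the maximum \<open>M\<close> of \<open>h\<close>: contract the trivial gap \<open>M\<close> of the zeroth iterate once.\<close>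
  have "M \<le> ?V ?d i0 + q * M" using contract[OF base, of i0] by (simp add: M_def)
  also have "\<dots> \<le> ?Kd + q * M" using taboo_iter_upper[of j ?d i0] by simp
  finally have M: "M \<le> ?Kd / (1 - q)" using q by (simp add: field_simps)
  have gap: "h y - ?V (n * ?d) y \<le> q ^ n * M" for n y
  proof (induction n arbitrary: y)
    case (Suc n)
    from contract[OF Suc, of y] show ?case by (simp add: algebra_simps)
  qed (use base in simp)
  have "\<gamma> / ?Kd \<le> (1 - max_avoid G j ?d i) / ?Kd"
    using max_avoid_le[OF G, of j i] Kd by (intro divide_right_mono) (auto simp: \<gamma>_def)
  also have "\<dots> \<le> ?V ?d i" by (rule taboo_iter_lower)
  also have "\<dots> \<le> ?V (k * ?d) i" using k by (intro taboo_iter_mono[OF G s]) simp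
  finally have V: "\<gamma> / ?Kd \<le> ?V (k * ?d) i" .
  have cancel: "c * y * e / x ^ 2 * (x / y) = e * (c / x)" if "x \<noteq> 0" "y \<noteq> 0" for x y c e :: real
    using that by (simp add: power2_eq_square)
  have "h i - ?V (k * ?d) i \<le> q ^ k * M" by (rule gap)
  also have "\<dots> \<le> q ^ k * (?Kd / (1 - q))" using M q0 by (intro mult_left_mono) auto
  also have "\<dots> \<le> \<gamma> * (1 - q) * (E - 1) / ?Kd ^ 2 * (?Kd / (1 - q))"
    using small Kd q by (intro mult_right_mono) auto
  also have "\<dots> = (E - 1) * (\<gamma> / ?Kd)"
    by (rule cancel) (use cost_ratio_ge_1 q in auto)
  also have "\<dots> \<le> (E - 1) * ?V (k * ?d) i" using V E by (intro mult_left_mono) auto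
  finally show ?thesis by (simp add: algebra_simps)
qed

end

section \<open>Optimal solutions of the linear programs and saddle points\<close>

lemma set_pmf_subset_of_sum:
  fixes p :: "'a::finite pmf"
  assumes "(\<Sum>a\<in>A. pmf p a) = 1"
  shows "set_pmf p \<subseteq> A"
proof -
  have "(\<Sum>a\<in>UNIV. pmf p a) = (\<Sum>a\<in>A. pmf p a) + (\<Sum>a\<in>-A. pmf p a)"
    by (subst sum.union_disjoint[symmetric]) (auto intro!: sum.cong)
  then have "(\<Sum>a\<in>-A. pmf p a) = 0" using assms by (simp add: sum_pmf_eq_1)
  then show ?thesis by (auto simp: sum_nonneg_eq_0_iff set_pmf_iff)
qed

lemma opLw_dirac_right:
  assumes "b \<in> actB G i"
  shows "opLw G \<mu> (dirac b) h i = (\<Sum>a\<in>actA G i. one_step G h i a b * \<mu> a)"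
  unfolding opLw_one_step dirac_def using assms
  by (intro sum.cong refl, subst sum.remove[of _ b]) (auto simp: pmf_return intro!: sum.neutral)

lemma opLw_dirac_left:
  assumes "a \<in> actA G i"
  shows "opLw G (dirac a) \<nu> h i = (\<Sum>b\<in>actB G i. one_step G h i a b * \<nu> b)"
  unfolding opLw_one_step dirac_def using assms
  by (subst sum.remove[of _ a]) (auto simp: pmf_return intro!: sum.neutral)

text \<open>
  The minimizer of the min-max problem is feasible together with the min-max value, so the optimum of the
  program is at most that value; its constraints are the guarantee against pure, hence against all mixed actions.
\<close>

lemma primal_optimal_guarantee:
  assumes G: "is_game G" and opt: "primal_optimal G h i w (pmf \<phi>)"
  shows "set_pmf \<phi> \<subseteq> actA G i"
    and "set_pmf \<nu> \<subseteq> actB G i \<Longrightarrow> opLw G (pmf \<phi>) (pmf \<nu>) h i \<le> opL G h i"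
proof -
  obtain p where p: "set_pmf p \<subseteq> actA G i"
    "\<And>\<nu>. set_pmf \<nu> \<subseteq> actB G i \<Longrightarrow> opLw G (pmf p) (pmf \<nu>) h i \<le> opL G h i"
    by (rule opL_saddle[OF G, of i h]) (rule that)
  have "primal_feasible G h i (opL G h i) (pmf p)"
    using p by (auto simp: primal_feasible_def dirac_def sum_pmf_eq_1)
  then have w: "w \<le> opL G h i" using opt by (auto simp: primal_optimal_def)
  show "set_pmf \<phi> \<subseteq> actA G i"
    using opt by (intro set_pmf_subset_of_sum) (auto simp: primal_optimal_def primal_feasible_def)
  assume \<nu>: "set_pmf \<nu> \<subseteq> actB G i"
  have "opLw G (pmf \<phi>) (pmf \<nu>) h i \<le> w"
    using opt by (intro opLw_le_col \<nu>) (auto simp: primal_optimal_def primal_feasible_def opLw_dirac_right)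
  then show "opLw G (pmf \<phi>) (pmf \<nu>) h i \<le> opL G h i" using w by simp
qed

lemma dual_optimal_guarantee:
  assumes G: "is_game G" and opt: "dual_optimal G h i v (pmf \<psi>)"
  shows "set_pmf \<psi> \<subseteq> actB G i"
    and "set_pmf \<mu> \<subseteq> actA G i \<Longrightarrow> opL G h i \<le> opLw G (pmf \<mu>) (pmf \<psi>) h i"
proof -
  obtain q where q: "set_pmf q \<subseteq> actB G i"
    "\<And>\<mu>. set_pmf \<mu> \<subseteq> actA G i \<Longrightarrow> opL G h i \<le> opLw G (pmf \<mu>) (pmf q) h i"
    by (rule opL_saddle[OF G, of i h]) (rule that)
  have "dual_feasible G h i (opL G h i) (pmf q)"
    using q by (auto simp: dual_feasible_def dirac_def sum_pmf_eq_1)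
  then have v: "opL G h i \<le> v" using opt by (auto simp: dual_optimal_def)
  show "set_pmf \<psi> \<subseteq> actB G i"
    using opt by (intro set_pmf_subset_of_sum) (auto simp: dual_optimal_def dual_feasible_def)
  assume \<mu>: "set_pmf \<mu> \<subseteq> actA G i"
  have "v \<le> opLw G (pmf \<mu>) (pmf \<psi>) h i"
    using opt by (intro opLw_ge_row \<mu>) (auto simp: dual_optimal_def dual_feasible_def opLw_dirac_left)
  then show "opL G h i \<le> opLw G (pmf \<mu>) (pmf \<psi>) h i" using v by simp
qed

lemma stationary_in_policies1:
  assumes "\<And>i. set_pmf (\<phi> i) \<subseteq> actA G i" shows "stationary \<phi> \<in> policies1 G"
  using assms by (auto simp: policies1_def stationary_def)

lemma stationary_in_policies2:
  assumes "\<And>i. set_pmf (\<psi> i) \<subseteq> actB G i" shows "stationary \<psi> \<in> policies2 G"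
  using assms by (auto simp: policies2_def stationary_def)

lemma avg_cost_stationary_upper:
  fixes G :: "('e::finite, 'a::finite, 'b::finite) game" and h :: "'e \<Rightarrow> real"
  assumes G: "is_game G" and h: "\<And>x. 0 < h x" and L: "0 < L"
    and \<phi>: "\<And>i. set_pmf (\<phi> i) \<subseteq> actA G i"
    and le: "\<And>i \<nu>. set_pmf \<nu> \<subseteq> actB G i \<Longrightarrow> opLw G (pmf (\<phi> i)) (pmf \<nu>) h i \<le> L * h i"
    and \<sigma>: "\<sigma> \<in> policies2 G"
  shows "avg_cost G i (stationary \<phi>) \<sigma> \<le> ereal (ln L / theta G)"
proof (rule avg_cost_upper[OF G h L stationary_in_policies1[OF \<phi>] \<sigma>])
  fix hs x assume "set hs \<subseteq> admissible G"
  then show "opLw G (pmf (stationary \<phi> hs x)) (pmf (\<sigma> hs x)) h x \<le> L * h x"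
    unfolding stationary_def by (intro le set_pmf_policies(2) \<sigma>)
qed

lemma avg_cost_stationary_lower:
  fixes G :: "('e::finite, 'a::finite, 'b::finite) game" and h :: "'e \<Rightarrow> real"
  assumes G: "is_game G" and h: "\<And>x. 0 < h x" and L: "0 < L"
    and \<psi>: "\<And>i. set_pmf (\<psi> i) \<subseteq> actB G i"
    and ge: "\<And>i \<mu>. set_pmf \<mu> \<subseteq> actA G i \<Longrightarrow> L * h i \<le> opLw G (pmf \<mu>) (pmf (\<psi> i)) h i"
    and \<pi>: "\<pi> \<in> policies1 G"
  shows "ereal (ln L / theta G) \<le> avg_cost G i \<pi> (stationary \<psi>)"
proof (rule avg_cost_lower[OF G h L \<pi> stationary_in_policies2[OF \<psi>]])
  fix hs x assume "set hs \<subseteq> admissible G"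
  then show "L * h x \<le> opLw G (pmf (\<pi> hs x)) (pmf (stationary \<psi> hs x)) h x"
    unfolding stationary_def by (intro ge set_pmf_policies(1) \<pi>)
qed

text \<open>
  A guarantee of each player at the same level \<open>V\<close> closes the gap in weak duality.
\<close>

lemma is_value_const:
  fixes G :: "('e::finite, 'a::finite, 'b::finite) game"
  assumes \<pi>: "\<pi>' \<in> policies1 G" "\<And>i \<sigma>. \<sigma> \<in> policies2 G \<Longrightarrow> avg_cost G i \<pi>' \<sigma> \<le> V i"
    and \<sigma>: "\<sigma>' \<in> policies2 G" "\<And>i \<pi>. \<pi> \<in> policies1 G \<Longrightarrow> V i \<le> avg_cost G i \<pi> \<sigma>'"
  shows "is_value G V"
proof -
  have "(INF \<pi> \<in> policies1 G. SUP \<sigma> \<in> policies2 G. avg_cost G i \<pi> \<sigma>) \<le> V i" for i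
    using \<pi> by (intro INF_lower2[OF \<pi>(1)] SUP_least)
  moreover have "V i \<le> (SUP \<sigma> \<in> policies2 G. INF \<pi> \<in> policies1 G. avg_cost G i \<pi> \<sigma>)" for i
    using \<sigma> by (intro SUP_upper2[OF \<sigma>(1)] INF_greatest)
  moreover have "(SUP \<sigma> \<in> policies2 G. INF \<pi> \<in> policies1 G. avg_cost G i \<pi> \<sigma>)
      \<le> (INF \<pi> \<in> policies1 G. SUP \<sigma> \<in> policies2 G. avg_cost G i \<pi> \<sigma>)" for i
    by (intro SUP_least INF_greatest) (meson INF_lower SUP_upper order.trans)
  ultimately show ?thesis unfolding is_value_def by (meson order.antisym order.trans)
qed

context multiplicative_eigenfunction
begin

lemma game_value: "is_value G (\<lambda>_. ereal (ln \<Lambda> / theta G))"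
proof -
  have "\<forall>i. \<exists>p. set_pmf p \<subseteq> actA G i \<and> (\<forall>\<nu>. set_pmf \<nu> \<subseteq> actB G i \<longrightarrow> opLw G (pmf p) (pmf \<nu>) h i \<le> \<Lambda> * h i)"
    unfolding eigen
  proof
    fix i show "\<exists>p. set_pmf p \<subseteq> actA G i \<and> (\<forall>\<nu>. set_pmf \<nu> \<subseteq> actB G i \<longrightarrow> opLw G (pmf p) (pmf \<nu>) h i \<le> opL G h i)"
      by (rule opL_saddle[OF G, of i h]) blast
  qed
  from choice[OF this] obtain \<phi> where \<phi>: "\<And>i. set_pmf (\<phi> i) \<subseteq> actA G i"
    "\<And>i \<nu>. set_pmf \<nu> \<subseteq> actB G i \<Longrightarrow> opLw G (pmf (\<phi> i)) (pmf \<nu>) h i \<le> \<Lambda> * h i" by blast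
  have "\<forall>i. \<exists>q. set_pmf q \<subseteq> actB G i \<and> (\<forall>\<mu>. set_pmf \<mu> \<subseteq> actA G i \<longrightarrow> \<Lambda> * h i \<le> opLw G (pmf \<mu>) (pmf q) h i)"
    unfolding eigen
  proof
    fix i show "\<exists>q. set_pmf q \<subseteq> actB G i \<and> (\<forall>\<mu>. set_pmf \<mu> \<subseteq> actA G i \<longrightarrow> opL G h i \<le> opLw G (pmf \<mu>) (pmf q) h i)"
      by (rule opL_saddle[OF G, of i h]) blast
  qed
  from choice[OF this] obtain \<psi> where \<psi>: "\<And>i. set_pmf (\<psi> i) \<subseteq> actB G i"
    "\<And>i \<mu>. set_pmf \<mu> \<subseteq> actA G i \<Longrightarrow> \<Lambda> * h i \<le> opLw G (pmf \<mu>) (pmf (\<psi> i)) h i" by blast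
  show ?thesis
    by (rule is_value_const[OF stationary_in_policies1[OF \<phi>(1)]
          avg_cost_stationary_upper[OF G h_pos eigenvalue_pos \<phi>]
          stationary_in_policies2[OF \<psi>(1)]
          avg_cost_stationary_lower[OF G h_pos eigenvalue_pos \<psi>]])
qed

text \<open>
  The approximation enters twice: once in comparing \<open>L U\<close> with \<open>L h\<close>, and once in returning from \<open>h\<close> to
  \<open>U\<close>. In either direction one of the two comparisons is free of charge, so the total error is \<open>\<epsilon>\<close>, not \<open>2\<epsilon>\<close>.
\<close>

lemma eps_saddle_point_of_approximation:
  assumes U: "\<And>i. U i \<le> h i" "\<And>i. h i \<le> exp (theta G * \<epsilon>) * U i"
    and prim: "\<And>i. primal_optimal G U i (w i) (pmf (\<phi> i))"
    and dual: "\<And>i. dual_optimal G U i (v i) (pmf (\<psi> i))"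
  shows "eps_saddle_point G \<epsilon> (stationary \<phi>) (stationary \<psi>)"
proof -
  have th: "0 < theta G" using G by (simp add: is_game_def)
  have U_pos: "0 < U i" for i
    using less_le_trans[OF h_pos U(2)] by (simp add: zero_less_mult_iff)
  let ?e = "exp (theta G * \<epsilon>)"
  note \<phi> = primal_optimal_guarantee[OF G prim] and \<psi> = dual_optimal_guarantee[OF G dual]
  have up: "opLw G (pmf (\<phi> i)) (pmf \<nu>) U i \<le> (\<Lambda> * ?e) * U i" if "set_pmf \<nu> \<subseteq> actB G i" for i \<nu>
  proof -
    have "opLw G (pmf (\<phi> i)) (pmf \<nu>) U i \<le> opL G h i"
      by (rule order.trans[OF \<phi>(2)[OF that] opL_mono[OF G]]) (rule U(1))
    also have "\<dots> = \<Lambda> * h i" by (simp add: eigen)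
    also have "\<dots> \<le> \<Lambda> * (?e * U i)" using U(2) eigenvalue_pos by (intro mult_left_mono) auto
    finally show ?thesis by (simp add: mult_ac)
  qed
  have lo: "(\<Lambda> * exp (- (theta G * \<epsilon>))) * U i \<le> opLw G (pmf \<mu>) (pmf (\<psi> i)) U i" if "set_pmf \<mu> \<subseteq> actA G i" for i \<mu>
  proof -
    have "(\<Lambda> * exp (- (theta G * \<epsilon>))) * U i \<le> (\<Lambda> * exp (- (theta G * \<epsilon>))) * h i"
      using U(1) eigenvalue_pos by (intro mult_left_mono) auto
    also have "\<dots> = opL G (\<lambda>y. exp (- (theta G * \<epsilon>)) * h y) i"
      by (simp add: opL_scale[OF G] flip: eigen)
    also have "\<dots> \<le> opL G U i"
      using U(2) by (intro opL_mono[OF G]) (simp add: exp_minus field_simps)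
    also have "\<dots> \<le> opLw G (pmf \<mu>) (pmf (\<psi> i)) U i" by (rule \<psi>(2)[OF that])
    finally show ?thesis .
  qed
  show ?thesis unfolding eps_saddle_point_def
  proof (intro conjI exI[of _ "\<lambda>_. ereal (ln \<Lambda> / theta G)"] allI ballI)
    show "stationary \<phi> \<in> policies1 G" by (rule stationary_in_policies1[OF \<phi>(1)])
    show "stationary \<psi> \<in> policies2 G" by (rule stationary_in_policies2[OF \<psi>(1)])
    show "is_value G (\<lambda>_. ereal (ln \<Lambda> / theta G))" by (rule game_value)
    fix i
    show "avg_cost G i (stationary \<phi>) \<sigma> \<le> ereal (ln \<Lambda> / theta G) + ereal \<epsilon>" if "\<sigma> \<in> policies2 G" for \<sigma>
      using avg_cost_stationary_upper[where i = i, OF G U_pos _ \<phi>(1) up that] eigenvalue_pos th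
      by (simp add: ln_mult add_divide_distrib)
    show "ereal (ln \<Lambda> / theta G) - ereal \<epsilon> \<le> avg_cost G i \<pi> (stationary \<psi>)" if "\<pi> \<in> policies1 G" for \<pi>
      using avg_cost_stationary_lower[where i = i, OF G U_pos _ \<psi>(1) lo that] eigenvalue_pos th
      by (simp add: ln_mult diff_divide_distrib)
  qed
qed

end

section \<open>The constants, and the approximate solution of the game\<close>

lemma U_eps_eq_taboo_iter:
  "U_eps G i\<^sub>0 \<epsilon> n = taboo_iter G i\<^sub>0 (exp (- theta G * rho_eps G \<epsilon>)) n"
proof -
  have d: "dirac i\<^sub>0 i = (if i = i\<^sub>0 then 1 else 0)" for i by (simp add: dirac_def pmf_return)
  show ?thesis
  proof (induction n)
    case (Suc n)
    show ?case by (rule ext) (simp add: Suc d)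
  qed (simp add: d fun_eq_iff)
qed

text \<open>
  The denominator in the definition of \<^const>\<open>k_eps\<close> is \<open>ln q < 0\<close>, so its defining inequality is the logarithm
  of the smallness of \<open>q ^ k\<close>. If the coefficient is 1 then \<open>q = 0\<close>, and one block of steps is enough.
\<close>

lemma k_eps_spec:
  fixes G :: "('e::finite, 'a::finite, 'b::finite) game" and \<epsilon> :: real
  defines "\<gamma> \<equiv> irreducibility_coeff G"
    and "m \<equiv> theta G * real CARD('e) * cost_span G"
  assumes \<gamma>: "0 < \<gamma>" "\<gamma> \<le> 1" and q: "(1 - \<gamma>) * exp m < 1" and eps: "0 < theta G * \<epsilon>"
  shows "1 \<le> k_eps G \<epsilon>"
    and "((1 - \<gamma>) * exp m) ^ k_eps G \<epsilon> < \<gamma> * (1 - (1 - \<gamma>) * exp m) * (exp (theta G * \<epsilon> / 2) - 1) / exp m ^ 2"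
proof -
  let ?q = "(1 - \<gamma>) * exp m"
  define R where "R = \<gamma> * (1 - ?q) * (exp (theta G * \<epsilon> / 2) - 1) / exp m ^ 2"
  have E: "1 < exp (theta G * \<epsilon> / 2)" using eps by simp
  have R: "0 < R" unfolding R_def using \<gamma> q E by (intro divide_pos_pos mult_pos_pos) auto
  have "1 \<le> k_eps G \<epsilon> \<and> ?q ^ k_eps G \<epsilon> < R"
  proof (cases "\<gamma> < 1")
    case False
    then have "\<gamma> = 1" using \<gamma> by simp
    then show ?thesis using R by (simp add: k_eps_def flip: \<gamma>_def)
  next
    case True
    let ?X = "ln \<gamma> + ln (1 - ?q) + ln (exp (theta G * \<epsilon> / 2) - 1) - 2 * m"
    let ?Y = "m + ln (1 - \<gamma>)"
    have ln_prod: "ln (x * y * z / exp m ^ 2) = ln x + ln y + ln z - 2 * m"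
      if "0 < x" "0 < y" "0 < z" for x y z :: real
      using that by (simp add: ln_div ln_mult ln_realpow)
    have lnR: "ln R = ?X"
      unfolding R_def by (rule ln_prod) (use \<gamma> q E in auto)
    have qpos: "0 < ?q" using True by simp
    have lnq: "ln ?q = ?Y" using True by (simp add: ln_mult)
    have neg: "?Y < 0" using qpos q unfolding lnq[symmetric] by (simp add: ln_less_zero)
    obtain k0 :: nat where "?X / ?Y < real k0" using reals_Archimedean2 by blast
    then have "1 \<le> Suc k0 \<and> ?X / ?Y < real (Suc k0)" by simp
    moreover have kdef: "k_eps G \<epsilon> = (LEAST k. 1 \<le> k \<and> ?X / ?Y < real k)"
      using True by (simp add: k_eps_def Let_def flip: \<gamma>_def m_def)
    ultimately have k: "1 \<le> k_eps G \<epsilon>" "?X / ?Y < real (k_eps G \<epsilon>)"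
      using LeastI[of "\<lambda>k. 1 \<le> k \<and> ?X / ?Y < real k" "Suc k0"] by auto
    have "real (k_eps G \<epsilon>) * ?Y < ?X" using k(2) neg by (simp add: neg_divide_less_eq)
    then have "ln (?q ^ k_eps G \<epsilon>) < ln R"
      using qpos by (simp add: lnR ln_realpow lnq)
    then show ?thesis using k(1) R qpos by (subst (asm) ln_less_cancel_iff) auto
  qed
  then show "1 \<le> k_eps G \<epsilon>" "?q ^ k_eps G \<epsilon> < \<gamma> * (1 - ?q) * (exp (theta G * \<epsilon> / 2) - 1) / exp m ^ 2"
    by (auto simp: R_def)
qed

theorem theorem4p1:
  fixes G :: "('e::finite, 'a::finite, 'b::finite) game"
    and i\<^sub>0 :: 'e and \<epsilon> :: real and hstar :: "'e \<Rightarrow> real"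
  assumes game: "is_game G"
    and irred: "irreducibility_condition G"
    and span: "cost_span G > 0"
    and eps: "\<epsilon> > 0"
    and theta: "irreducibility_coeff G < 1 \<Longrightarrow>
      theta G < - ln (1 - irreducibility_coeff G) / (real CARD('e) * cost_span G)"
    and hstar_pos: "\<And>i. hstar i > 0"
    and hstar_eigen: "\<And>i. lambda_star G * hstar i = opL G hstar i"
    and hstar_norm: "hstar i\<^sub>0 = 1"
  shows "(\<forall>i. U_eps G i\<^sub>0 \<epsilon> (N_eps G \<epsilon>) i \<le> hstar i \<and>
              hstar i \<le> exp (theta G * \<epsilon>) * U_eps G i\<^sub>0 \<epsilon> (N_eps G \<epsilon>) i) \<and>
         (\<forall>(w :: 'e \<Rightarrow> real) (\<phi> :: 'e \<Rightarrow> 'a pmf) (v :: 'e \<Rightarrow> real) (\<psi> :: 'e \<Rightarrow> 'b pmf).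
            (\<forall>i. primal_optimal G (U_eps G i\<^sub>0 \<epsilon> (N_eps G \<epsilon>)) i (w i) (pmf (\<phi> i))) \<and>
            (\<forall>i. dual_optimal G (U_eps G i\<^sub>0 \<epsilon> (N_eps G \<epsilon>)) i (v i) (pmf (\<psi> i)))
            \<longrightarrow> eps_saddle_point G \<epsilon> (stationary \<phi>) (stationary \<psi>))"
proof -
  interpret multiplicative_eigenfunction G hstar "lambda_star G"
    using game hstar_pos hstar_eigen by unfold_locales
  let ?\<gamma> = "irreducibility_coeff G" and ?d = "CARD('e)" and ?N = "N_eps G \<epsilon>"
  let ?m = "theta G * real ?d * cost_span G"
  let ?q = "(1 - ?\<gamma>) * exp ?m" and ?E = "exp (theta G * \<epsilon> / 2)"
  have th: "0 < theta G" using game by (simp add: is_game_def)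
  then have m: "0 < ?m" using span by simp
  have \<gamma>1: "?\<gamma> \<le> 1" by (rule irreducibility_coeff_le_1[OF game])
  \<comment> \<open>The bound on \<open>\<theta>\<close> says that \<open>ln (1 - \<gamma>)\<close> is below \<open>- \<theta>dM < 0\<close>, so it also forces \<open>\<gamma> > 0\<close>.\<close>
  have "0 < ?\<gamma> \<and> ?q < 1"
  proof (cases "?\<gamma> < 1")
    case True
    have "?m < - ln (1 - ?\<gamma>)"
      using theta[OF True] span by (subst (asm) pos_less_divide_eq) (simp_all add: mult.assoc)
    then have less: "ln (1 - ?\<gamma>) < - ?m" by simp
    then have "ln (1 - ?\<gamma>) < 0" using m by linarith
    moreover have "?q < 1"
    proof -
      have "1 - ?\<gamma> < exp (- ?m)" using less True by (metis diff_gt_0_iff_gt exp_less_mono exp_ln)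
      then show ?thesis by (simp add: exp_minus field_simps)
    qed
    ultimately show ?thesis using True by (simp add: ln_less_zero_iff)
  qed (use \<gamma>1 in auto)
  then have \<gamma>0: "0 < ?\<gamma>" and q: "?q < 1" by auto
  have te: "0 < theta G * \<epsilon>" using th eps by simp
  note k = k_eps_spec[OF \<gamma>0 \<gamma>1 q te]
  have N: "?N = k_eps G \<epsilon> * ?d" "0 < ?N" using k(1) by (auto simp: N_eps_def)
  have Kd: "cost_ratio ^ ?d = exp ?m" by (simp add: cost_ratio_def mult_ac flip: exp_of_nat_mult)
  have V: "hstar i \<le> ?E * taboo_iter G i\<^sub>0 (1 / lambda_star G) ?N i" for i
    unfolding N(1)
    by (rule eigenfunction_le_taboo_iter) (use k \<gamma>0 q hstar_norm te in \<open>simp_all add: Kd\<close>)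
  define s where "s = exp (- theta G * rho_eps G \<epsilon>)"
  \<comment> \<open>The quotient of the eigenvalue and its estimate; it is at least \<open>exp (- \<theta>\<epsilon>/(2N))\<close>.\<close>
  define r where "r = lambda_star G * s"
  note rho = exp_rho_eps_bounds[OF eps N(2)]
  have s_eq: "s = 1 / exp (theta G * rho_eps G \<epsilon>)" by (simp add: s_def exp_minus divide_inverse)
  have r01: "0 \<le> r" "r \<le> 1" using rho(1) eigenvalue_pos by (simp_all add: r_def s_eq)
  have U: "U_eps G i\<^sub>0 \<epsilon> ?N i = taboo_iter G i\<^sub>0 s ?N i" for i
    by (simp add: U_eps_eq_taboo_iter s_def)
  have lower: "U_eps G i\<^sub>0 \<epsilon> ?N i \<le> hstar i" for i
    unfolding U using hstar_norm rho(1) eigenvalue_pos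
    by (intro taboo_iter_le_eigenfunction) (auto simp: s_eq frac_le)
  have upper: "hstar i \<le> exp (theta G * \<epsilon>) * U_eps G i\<^sub>0 \<epsilon> ?N i" for i
  proof -
    let ?V = "taboo_iter G i\<^sub>0 (1 / lambda_star G) ?N i"
    have "1 \<le> exp (theta G * \<epsilon> / (2 * real ?N)) * r"
      using rho(2) by (simp add: r_def s_eq field_simps)
    then have "1 \<le> (exp (theta G * \<epsilon> / (2 * real ?N)) * r) ^ ?N" by (rule one_le_power)
    also have "\<dots> = ?E * r ^ ?N" using N(2) by (simp add: power_mult_distrib flip: exp_of_nat_mult)
    finally have 1: "1 \<le> ?E * r ^ ?N" .
    have V0: "0 \<le> ?V" using eigenvalue_pos by (intro taboo_iter_nonneg[OF game]) auto
    have "hstar i \<le> ?E * ?V" by (rule V)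
    also have "\<dots> \<le> ?E * ((?E * r ^ ?N) * ?V)"
      using mult_right_mono[OF 1 V0] by (intro mult_left_mono) auto
    also have "\<dots> = exp (theta G * \<epsilon>) * (r ^ ?N * ?V)"
      by (simp add: mult_ac flip: exp_add)
    also have "\<dots> \<le> exp (theta G * \<epsilon>) * taboo_iter G i\<^sub>0 s ?N i"
      using r01 eigenvalue_pos by (intro mult_left_mono taboo_iter_discount) (auto simp: r_def)
    finally show ?thesis unfolding U .
  qed
  show ?thesis
    using lower upper eps_saddle_point_of_approximation[OF lower upper] by blast
qed

end
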